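(* Let $G=(V,E)$ be a graph with $k$ connected components. Then \[ (1+3z)^{|V|-k}(1+z)^{|E|-|V|+k}\preccurlyeq h^\ast(\mathcal{C}_G;z). \] Equality is attained if and only if $G$ can be obtained as a $1$-sum of loops and a forest.
   Context: A graph $G=(V,E)$ is a finite undirected graph with vertex set $V$ and a finite multiset $E$ of edges; multiple edges and loops are allowed, and $G$ has no isolated vertices. The $1$-sum of two graphs on disjoint vertex sets with respect to vertices $v$ (of the first) and $w$ (of the second) is obtained from their disjoint union by identifying $v$ and $w$. A "loop" here means the graph consisting of one vertex and one loop at it. Let $\mathbb{R}^{V\cup E}$ have standard unit vectors $\mathbf{e}_\alpha$. The cosmological polytope is $\mathcal{C}_G=\mathrm{conv}(\mathbf{e}_i+\mathbf{e}_j-\mathbf{e}_f,\ \mathbf{e}_i-\mathbf{e}_j+\mathbf{e}_f,\ -\mathbf{e}_i+\mathbf{e}_j+\mathbf{e}_f : f\in E \text{ with endpoints } i,j)$, of dimension $|V|+|E|-1$. For a $d$-dimensional lattice polytope $P\subset\mathbb{R}^N$, $h^\ast(P;z)$ is defined by $1+\sum_{t\ge1}|tP\cap\mathbb{Z}^N|z^t=h^\ast(P;z)/(1-z)^{d+1}$. For polynomials $f=\sum a_iz^i$, $g=\sum b_iz^i$ (coefficients beyond the degree being $0$), $f\preccurlyeq g$ means $a_i\le b_i$ for all $i\ge0$. *)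

theory Defs
  imports
    "HOL-Analysis.Analysis"
    "HOL-Computational_Algebra.Polynomial_FPS"
    "HOL-Library.Uprod"
begin

section \<open>Multigraphs\<close>

text \<open>A multiset of edges is represented by a set of edge names together with a map giving the
  unordered pair of endpoints of each name. Parallel edges are distinct names with the same
  endpoints; a loop has endpoints \<open>Upair v v\<close>. Only the values of \<open>ends\<close> on \<open>edges\<close> matter.\<close>

record ('v, 'e) multigraph =
  verts :: "'v set"
  edges :: "'e set"
  ends :: "'e \<Rightarrow> 'v uprod"

definition finite_multigraph :: "('v, 'e) multigraph \<Rightarrow> bool" where
  "finite_multigraph G \<longleftrightarrow>
     finite (verts G) \<and> finite (edges G) \<and> (\<forall>f\<in>edges G. set_uprod (ends G f) \<subseteq> verts G)"

definition no_isolated_vertices :: "('v, 'e) multigraph \<Rightarrow> bool" where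
  "no_isolated_vertices G \<longleftrightarrow> (\<forall>v\<in>verts G. \<exists>f\<in>edges G. v \<in> set_uprod (ends G f))"

definition adjacency :: "('v, 'e) multigraph \<Rightarrow> ('v \<times> 'v) set" where
  "adjacency G = {(u, v). \<exists>f\<in>edges G. ends G f = Upair u v}"

definition connected_components :: "('v, 'e) multigraph \<Rightarrow> 'v set set" where
  "connected_components G = verts G // {(u, v) \<in> verts G \<times> verts G. (u, v) \<in> (adjacency G)\<^sup>*}"

text \<open>The cycle \<open>v\<^sub>0 f\<^sub>0 v\<^sub>1 f\<^sub>1 \<dots> v\<^sub>n\<^sub>-\<^sub>1 f\<^sub>n\<^sub>-\<^sub>1 v\<^sub>0\<close> with \<open>n \<ge> 1\<close>. A loop is a cycle of length 1, and two
  parallel edges form a cycle of length 2.\<close>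

definition is_cycle :: "('v, 'e) multigraph \<Rightarrow> 'v list \<Rightarrow> 'e list \<Rightarrow> bool" where
  "is_cycle G vs fs \<longleftrightarrow>
     fs \<noteq> [] \<and> length vs = length fs \<and> distinct vs \<and> distinct fs \<and>
     set vs \<subseteq> verts G \<and> set fs \<subseteq> edges G \<and>
     (\<forall>i<length fs. ends G (fs ! i) = Upair (vs ! i) (vs ! (Suc i mod length fs)))"

text \<open>Forests may have isolated vertices (and may be empty): a connected component of a graph
  may consist of loops at a single vertex, and then arises by attaching loops to an isolated
  vertex of the forest.\<close>

definition is_forest :: "('v, 'e) multigraph \<Rightarrow> bool" where
  "is_forest G \<longleftrightarrow> finite_multigraph G \<and> (\<nexists>vs fs. is_cycle G vs fs)"

definition is_loop_graph :: "('v, 'e) multigraph \<Rightarrow> bool" where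
  "is_loop_graph L \<longleftrightarrow> (\<exists>v f. verts L = {v} \<and> edges L = {f} \<and> ends L f = Upair v v)"

definition isomorphic :: "('v, 'e) multigraph \<Rightarrow> ('w, 'f) multigraph \<Rightarrow> bool" where
  "isomorphic G H \<longleftrightarrow>
     (\<exists>\<phi> \<psi>. bij_betw \<phi> (verts G) (verts H) \<and> bij_betw \<psi> (edges G) (edges H) \<and>
        (\<forall>f\<in>edges G. ends H (\<psi> f) = map_uprod \<phi> (ends G f)))"

text \<open>The sum types make the two graphs disjoint; \<open>Inl v\<close> plays the role of the vertex obtained
  by identifying \<open>v\<close> and \<open>w\<close>.\<close>

definition one_sum ::
    "('v, 'e) multigraph \<Rightarrow> 'v \<Rightarrow> ('w, 'f) multigraph \<Rightarrow> 'w \<Rightarrow> ('v + 'w, 'e + 'f) multigraph" where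
  "one_sum G v H w =
     \<lparr> verts = Inl ` verts G \<union> Inr ` (verts H - {w}),
       edges = Inl ` edges G \<union> Inr ` edges H,
       ends = case_sum
         (\<lambda>f. map_uprod Inl (ends G f))
         (\<lambda>f. map_uprod (\<lambda>x. if x = w then Inl v else Inr x) (ends H f)) \<rparr>"

text \<open>Graphs obtained, up to isomorphism, from a forest by successively taking 1-sums with
  finitely many (possibly no) loops.\<close>

inductive one_sum_of_loops_and_forest :: "('v, 'e) multigraph \<Rightarrow> bool" where
  forest: "is_forest F \<Longrightarrow> one_sum_of_loops_and_forest F"
| attach_loop: "\<lbrakk>one_sum_of_loops_and_forest H; is_loop_graph (L :: ('v, 'e) multigraph);
    v \<in> verts H; w \<in> verts L; isomorphic G (one_sum H v L w)\<rbrakk> \<Longrightarrow> one_sum_of_loops_and_forest G"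


section \<open>Cosmological polytopes\<close>

text \<open>The space \<open>\<real>\<^bsup>V \<union> E\<^esup>\<close> is the coordinate subspace of \<open>real ^ ('v + 'e)\<close> belonging to
  \<open>Inl ` verts G \<union> Inr ` edges G\<close>; all generators have the other coordinates equal to 0.
  For a loop, \<open>i = j\<close>. Both orderings of the endpoints of \<open>f\<close> are included, which does not
  change the set of generators.\<close>

definition unit_vec :: "'a::finite \<Rightarrow> real ^ 'a" where
  "unit_vec a = axis a 1"

definition cosmological_polytope ::
    "('v::finite, 'e::finite) multigraph \<Rightarrow> (real ^ ('v + 'e)) set" where
  "cosmological_polytope G = convex hull
     (\<Union>{{unit_vec (Inl i) + unit_vec (Inl j) - unit_vec (Inr f),
           unit_vec (Inl i) - unit_vec (Inl j) + unit_vec (Inr f),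
           - unit_vec (Inl i) + unit_vec (Inl j) + unit_vec (Inr f)} | i j f.
          f \<in> edges G \<and> ends G f = Upair i j})"


section \<open>The \<open>h\<^sup>*\<close>-polynomial\<close>

definition lattice_points :: "(real ^ 'n) set \<Rightarrow> (real ^ 'n) set" where
  "lattice_points S = {x \<in> S. \<forall>a. x $ a \<in> \<int>}"

definition ehrhart_series :: "(real ^ 'n) set \<Rightarrow> real fps" where
  "ehrhart_series P =
     1 + Abs_fps (\<lambda>t. if t \<ge> 1 then of_nat (card (lattice_points ((\<lambda>x. real t *\<^sub>R x) ` P))) else 0)"

text \<open>The polynomial is unique since \<open>fps_of_poly\<close> is injective, and it exists for every lattice
  polytope. The empty polytope has affine dimension \<open>-1\<close> and \<open>h\<^sup>* = 1\<close>.\<close>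

definition h_star :: "(real ^ 'n) set \<Rightarrow> real poly" where
  "h_star P =
     (THE h. ehrhart_series P = fps_of_poly h / (1 - fps_X) ^ nat (aff_dim P + 1))"

definition coeff_le :: "real poly \<Rightarrow> real poly \<Rightarrow> bool"  (infix \<open>\<preceq>\<close> 50) where
  "f \<preceq> g \<longleftrightarrow> (\<forall>i. coeff f i \<le> coeff g i)"

end

theory Submission imports Defs begin

text \<open>The lattice points of the cone over \<open>C\<^sub>G\<close> are the integral \<open>(x, y)\<close> such that every vertex set \<open>S\<close>
  has nonnegative slack, a submodular function of \<open>S\<close>. Slice this set by the value \<open>m\<close> of
  \<open>y\<close> at an edge \<open>e = ij\<close>. For \<open>m \<le> 0\<close> the slice is a translate of the point set of \<open>G - e\<close>. For \<open>m \<ge> 0\<close>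
  submodularity shows that it is the union of the translates of the point set of \<open>G - e\<close> by
  \<open>c (e\<^sub>j - e\<^sub>i)\<close>, \<open>\<bar>c\<bar> \<le> m\<close>. The lines in direction \<open>e\<^sub>j - e\<^sub>i\<close> meeting the point set of \<open>G - e\<close> correspond to
  the points of \<open>G / e\<close> and meet it in intervals, so each of them gains \<open>2 m\<close> points. Summing over \<open>m\<close>,
  \<open>h\<^sup>*(G) = (1 + z) h\<^sup>*(G - e) + 2 z h\<^sup>*(G / e)\<close> for non-loops and \<open>h\<^sup>*(G) = (1 + z) h\<^sup>*(G - e)\<close> for loops.
  By induction on the number of edges, a non-loop that is not a bridge makes the inequality strict, and
  if every non-loop is a bridge then equality propagates.\<close>

text \<open>The factors of the recursion are generating functions over the slice index: the sum of
  z^|m| over all integers m is (1 + z)/(1 - z), and the sum of 2 m z^m over m >= 0 is 2 z/(1 - z)^2.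
  Deletion lowers |V| + |E| by one and contraction of a non-loop by two, which is exactly what these
  denominators absorb. For a bridge, G - e and G / e have the same lower bound B, and (1 + z) B + 2
  z B = (1 + 3 z) B is the origin of 1 + 3 z. For any other edge the bound of G is (1 + z) times
  that of G - e, so the term from G / e is pure excess, and the constant coefficient 1 of its
  numerator shows in the coefficient of z. No inequality is ever needed at a bridge: an edge that is
  neither a loop nor a bridge is chosen whenever there is one. Only integral points have to be
  recognised as points of the cone. Lowering a positive \<open>y e\<close> in unit steps keeps
  everything integral, so one argument gives both the sufficiency of the slack inequalities and the
  shape of the slices.\<close>

section \<open>Slack functions and lattice points of the cone\<close>

text \<open>The minimum of \<open>\<beta> * y\<close> over the weights \<open>\<beta>\<close> for which \<open>\<beta>\<close> and the values of the indicator of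
  \<open>S\<close> at the endpoints satisfy the triangle inequalities, i.e. for which the functional given by
  the indicator and \<open>\<beta>\<close> is nonnegative on the generators of the edge.\<close>

definition edge_term :: "('e \<Rightarrow> 'v) \<Rightarrow> ('e \<Rightarrow> 'v) \<Rightarrow> 'v set \<Rightarrow> 'e \<Rightarrow> 'c \<Rightarrow> 'c::linordered_idom" where
  "edge_term a b S f y =
     min (of_bool ((a f \<in> S) \<noteq> (b f \<in> S)) * y) ((of_bool (a f \<in> S) + of_bool (b f \<in> S)) * y)"

definition slack ::
    "('e::finite \<Rightarrow> 'v::finite) \<Rightarrow> ('e \<Rightarrow> 'v) \<Rightarrow> ('v \<Rightarrow> 'c) \<Rightarrow> ('e \<Rightarrow> 'c) \<Rightarrow> 'v set \<Rightarrow> 'c::linordered_idom" where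
  "slack a b x y S = (\<Sum>v\<in>S. x v) + (\<Sum>f\<in>UNIV. edge_term a b S f (y f))"

text \<open>Points stay functions on the full types, vanishing outside \<open>V\<close> and
  \<open>E\<close>, so that deletion and contraction do not change the type.\<close>

definition cone_points ::
    "'v::finite set \<Rightarrow> 'e::finite set \<Rightarrow> ('e \<Rightarrow> 'v) \<Rightarrow> ('e \<Rightarrow> 'v) \<Rightarrow> (('v \<Rightarrow> int) \<times> ('e \<Rightarrow> int)) set" where
  "cone_points V E a b =
     {(x, y). (\<forall>v. v \<notin> V \<longrightarrow> x v = 0) \<and> (\<forall>f. f \<notin> E \<longrightarrow> y f = 0) \<and> (\<forall>S. 0 \<le> slack a b x y S)}"

definition level ::
    "'v::finite set \<Rightarrow> 'e::finite set \<Rightarrow> ('e \<Rightarrow> 'v) \<Rightarrow> ('e \<Rightarrow> 'v) \<Rightarrow> int \<Rightarrow> (('v \<Rightarrow> int) \<times> ('e \<Rightarrow> int)) set" where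
  "level V E a b n = {(x, y) \<in> cone_points V E a b. sum x UNIV + sum y UNIV = n}"

definition shift :: "'v \<Rightarrow> 'v \<Rightarrow> int \<Rightarrow> ('v \<Rightarrow> int) \<Rightarrow> 'v \<Rightarrow> int" where
  "shift i j c x = (\<lambda>v. x v + c * (of_bool (v = j) - of_bool (v = i)))"

lemma edge_term_0 [simp]: "edge_term a b S f 0 = 0"
  by (simp add: edge_term_def)

lemma edge_term_nonneg: "y \<ge> 0 \<Longrightarrow> edge_term a b S f y = of_bool ((a f \<in> S) \<noteq> (b f \<in> S)) * y"
  by (auto simp: edge_term_def)

lemma edge_term_nonpos: "y \<le> 0 \<Longrightarrow> edge_term a b S f y = (of_bool (a f \<in> S) + of_bool (b f \<in> S)) * y"
  by (auto simp: edge_term_def)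

lemma sum_mult_of_bool_eq:
  fixes S :: "'v::finite set" and c :: "'c::comm_ring_1"
  shows "(\<Sum>v\<in>S. c * of_bool (v = i)) = c * of_bool (i \<in> S)"
  by (simp add: of_bool_def if_distrib sum.delta cong: if_cong)

lemma sum_shift:
  fixes S :: "'v::finite set"
  shows "sum (shift i j c x) S = sum x S + c * (of_bool (j \<in> S) - of_bool (i \<in> S))"
  by (simp add: shift_def sum.distrib right_diff_distrib sum_subtractf sum_mult_of_bool_eq)

lemma slack_shift:
  "slack a b (shift i j c x) y S = slack a b x y S + c * (of_bool (j \<in> S) - of_bool (i \<in> S))"
  by (simp add: slack_def sum_shift)

lemma shift_0 [simp]: "shift i j 0 x = x"
  by (simp add: shift_def)

lemma shift_shift [simp]: "shift i j c (shift i j d x) = shift i j (c + d) x"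
  by (auto simp: shift_def algebra_simps)

lemma slack_fun_upd:
  "slack a b x (y(e := m)) S
     = slack a b x y S - edge_term a b S e (y e) + edge_term a b S e m"
proof -
  have "(\<Sum>f\<in>UNIV. edge_term a b S f ((y(e := m)) f))
     = edge_term a b S e m + (\<Sum>f\<in>UNIV - {e}. edge_term a b S f (y f))"
    by (subst sum.remove[of _ e]) (auto intro!: sum.cong)
  moreover have "(\<Sum>f\<in>UNIV. edge_term a b S f (y f))
     = edge_term a b S e (y e) + (\<Sum>f\<in>UNIV - {e}. edge_term a b S f (y f))"
    by (rule sum.remove) auto
  ultimately show ?thesis
    by (simp add: slack_def)
qed

lemma sum_fun_upd_UNIV:
  fixes y :: "'e::finite \<Rightarrow> int"
  shows "sum (y(e := m)) UNIV = sum y UNIV - y e + m" (is ?A)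
    and "(\<Sum>f\<in>UNIV. if f = e then m else y f) = sum y UNIV - y e + m" (is ?B)
proof -
  have "sum (y(e := m)) UNIV = m + sum y (UNIV - {e})"
    by (subst sum.remove[of _ e]) (auto intro!: sum.cong)
  moreover have "sum y UNIV = y e + sum y (UNIV - {e})"
    by (rule sum.remove) auto
  ultimately show ?A by simp
  then show ?B by (simp add: fun_upd_def)
qed

lemma shift_outside: "i \<in> V \<Longrightarrow> j \<in> V \<Longrightarrow> v \<notin> V \<Longrightarrow> shift i j c x v = x v"
  by (auto simp: shift_def)

lemma shift_at: "i \<noteq> j \<Longrightarrow> shift i j c x j = x j + c"
  by (simp add: shift_def)

lemma sum_shift_UNIV [simp]: "sum (shift i j c x) (UNIV :: 'v::finite set) = sum x UNIV"
  by (simp add: sum_shift)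

text \<open>For \<open>y \<ge> 0\<close> this is a multiple of a cut function; for
  \<open>y \<le> 0\<close> it is modular.\<close>

lemma edge_term_submodular:
  fixes y :: "'c::linordered_idom"
  shows "edge_term a b (S \<inter> T) f y + edge_term a b (S \<union> T) f y \<le> edge_term a b S f y + edge_term a b T f y"
  by (cases "y \<ge> 0") (auto simp: edge_term_nonneg edge_term_nonpos of_bool_def)

text \<open>The gain \<open>2 * y e\<close> is the cut value of \<open>e\<close>, present for both
  \<open>S\<close> and \<open>T\<close> but for neither their intersection nor their union.\<close>

lemma slack_submodular:
  fixes x :: "'v::finite \<Rightarrow> int" and y :: "'e::finite \<Rightarrow> int"
  assumes "a e \<in> S" "b e \<notin> S" "b e \<in> T" "a e \<notin> T" "y e \<ge> 0"
  shows "slack a b x y (S \<inter> T) + slack a b x y (S \<union> T) + 2 * y e \<le> slack a b x y S + slack a b x y T"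
proof -
  have "sum x (S \<inter> T) + sum x (S \<union> T) = sum x S + sum x T"
    by (metis add.commute finite sum.union_inter)
  moreover have "slack a b x (y(e := 0)) (S \<inter> T) + slack a b x (y(e := 0)) (S \<union> T) - sum x (S \<inter> T) - sum x (S \<union> T)
      \<le> slack a b x (y(e := 0)) S + slack a b x (y(e := 0)) T - sum x S - sum x T"
    by (simp add: slack_def sum.distrib[symmetric] del: fun_upd_apply)
      (rule sum_mono, rule edge_term_submodular)
  moreover have "edge_term a b (S \<inter> T) e (y e) + edge_term a b (S \<union> T) e (y e) + 2 * y e
      = edge_term a b S e (y e) + edge_term a b T e (y e)"
    using assms by (auto simp: edge_term_nonneg)
  ultimately show ?thesis
    by (simp add: slack_fun_upd)
qed

text \<open>Lowering \<open>y e\<close> lowers the slack of the sets separating the endpoints of \<open>e\<close>. By submodularity,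
  tight sets cannot separate them in both directions, so a unit shift along \<open>e\<close> compensates.\<close>

lemma peel_edge:
  fixes x :: "'v::finite \<Rightarrow> int" and y :: "'e::finite \<Rightarrow> int"
  assumes nn: "\<And>S. 0 \<le> slack a b x y S" and ne: "a e \<noteq> b e" and y: "y e \<ge> 1"
  obtains c where "\<bar>c\<bar> \<le> 1" "\<And>S. 0 \<le> slack a b (shift (a e) (b e) c x) (y(e := y e - 1)) S"
proof -
  have sl: "slack a b (shift (a e) (b e) c x) (y(e := y e - 1)) S =
      slack a b x y S + c * (of_bool (b e \<in> S) - of_bool (a e \<in> S)) - of_bool ((a e \<in> S) \<noteq> (b e \<in> S))" for c S
    using y by (simp add: slack_shift slack_fun_upd edge_term_nonneg algebra_simps)
  \<comment> \<open>If one of the two sets is tight, the other has slack at least 2: one unit pays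
    for lowering \<open>y e\<close>, the other for the unit shift that helps the tight set.\<close>
  have far: "slack a b x y S + slack a b x y T \<ge> 2"
    if "a e \<in> S" "b e \<notin> S" "b e \<in> T" "a e \<notin> T" for S T
    using slack_submodular[of a e S b T y x, OF that] y nn[of "S \<inter> T"] nn[of "S \<union> T"] by linarith
  consider (none) "\<And>S. (a e \<in> S) \<noteq> (b e \<in> S) \<Longrightarrow> slack a b x y S \<ge> 1"
    | (i) S where "a e \<in> S" "b e \<notin> S" "slack a b x y S \<le> 0"
    | (j) S where "a e \<notin> S" "b e \<in> S" "slack a b x y S \<le> 0"
    by (metis int_one_le_iff_zero_less not_less)
  then show ?thesis
  proof cases
    case none
    have "0 \<le> slack a b (shift (a e) (b e) 0 x) (y(e := y e - 1)) S" for S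
      using none[of S] nn[of S] unfolding sl by (cases "a e \<in> S"; cases "b e \<in> S") auto
    then show ?thesis using that[of 0] by auto
  next
    case i
    have "0 \<le> slack a b (shift (a e) (b e) (-1) x) (y(e := y e - 1)) S'" for S'
      using far[OF i(1,2), of S'] i(3) nn[of S'] unfolding sl
      by (cases "a e \<in> S'"; cases "b e \<in> S'") auto
    then show ?thesis using that[of "-1"] by auto
  next
    case j
    have "0 \<le> slack a b (shift (a e) (b e) 1 x) (y(e := y e - 1)) S'" for S'
      using far[of S', OF _ _ j(2,1)] j(3) nn[of S'] unfolding sl
      by (cases "a e \<in> S'"; cases "b e \<in> S'") auto
    then show ?thesis using that[of 1] by auto
  qed
qed

text \<open>Iterating \<open>peel_edge\<close> brings \<open>y e\<close> down to 0 with total shift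
  at most \<open>y e\<close>. Conversely, a shift by \<open>c\<close> changes only the slack of
  separating sets, by at most \<open>\<bar>c\<bar>\<close>, and the weight on \<open>e\<close> makes
  up for it.\<close>

lemma nonneg_slice_iff:
  fixes x :: "'v::finite \<Rightarrow> int" and y :: "'e::finite \<Rightarrow> int"
  assumes ne: "a e \<noteq> b e" and y: "y e \<ge> 0"
  shows "(\<forall>S. 0 \<le> slack a b x y S) \<longleftrightarrow>
     (\<exists>c. \<bar>c\<bar> \<le> y e \<and> (\<forall>S. 0 \<le> slack a b (shift (a e) (b e) c x) (y(e := 0)) S))"
proof
  assume "\<forall>S. 0 \<le> slack a b x y S"
  then show "\<exists>c. \<bar>c\<bar> \<le> y e \<and> (\<forall>S. 0 \<le> slack a b (shift (a e) (b e) c x) (y(e := 0)) S)"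
    using y
  proof (induction "nat (y e)" arbitrary: x y)
    case 0
    then have "y(e := 0) = y" by auto
    with 0 show ?case by (auto intro!: exI[of _ 0])
  next
    case (Suc n)
    then have "y e \<ge> 1" by linarith
    then obtain c where c: "\<bar>c\<bar> \<le> 1" "\<And>S. 0 \<le> slack a b (shift (a e) (b e) c x) (y(e := y e - 1)) S"
      using peel_edge[of a b x y e] Suc.prems ne by blast
    have "n = nat ((y(e := y e - 1)) e)" using Suc.hyps(2) by simp
    from Suc.hyps(1)[of "y(e := y e - 1)" "shift (a e) (b e) c x", OF this] c(2) \<open>y e \<ge> 1\<close>
    obtain d where d: "\<bar>d\<bar> \<le> y e - 1"
      "\<And>S. 0 \<le> slack a b (shift (a e) (b e) d (shift (a e) (b e) c x)) ((y(e := y e - 1))(e := 0)) S"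
      by auto
    then show ?case
      using c by (intro exI[of _ "d + c"]) (auto simp: fun_upd_upd)
  qed
next
  assume "\<exists>c. \<bar>c\<bar> \<le> y e \<and> (\<forall>S. 0 \<le> slack a b (shift (a e) (b e) c x) (y(e := 0)) S)"
  then obtain c where c: "\<bar>c\<bar> \<le> y e" "\<And>S. 0 \<le> slack a b (shift (a e) (b e) c x) (y(e := 0)) S"
    by blast
  have "0 \<le> slack a b x y S" for S
    using c(1) c(2)[of S] y
    by (cases "a e \<in> S"; cases "b e \<in> S") (auto simp: slack_shift slack_fun_upd edge_term_nonneg)
  then show "\<forall>S. 0 \<le> slack a b x y S" by blast
qed

text \<open>A nonpositive weight makes the term of \<open>e\<close> modular, so it can be moved into
  the vertex coordinates; this removes \<open>- y e\<close> copies of the generator e_i + e_j -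
  e_f.\<close>

lemma neg_slice:
  fixes x :: "'v::finite \<Rightarrow> int" and y :: "'e::finite \<Rightarrow> int"
  assumes "y e \<le> 0"
  shows "slack a b x y S =
     slack a b (\<lambda>v. x v + y e * (of_bool (v = a e) + of_bool (v = b e))) (y(e := 0)) S"
  using assms unfolding slack_fun_upd
  by (simp add: slack_def edge_term_nonpos sum.distrib distrib_left sum_mult_of_bool_eq algebra_simps)

lemma loop_slice:
  assumes "a e = b e" "y e \<ge> 0"
  shows "slack a b x y S = slack a b x (y(e := 0)) S"
  using assms unfolding slack_fun_upd by (simp add: edge_term_nonneg)

section \<open>Slices of the cone along an edge\<close>

lemma level_iff:
  "(x, y) \<in> level V E a b n \<longleftrightarrow>
     (\<forall>v. v \<notin> V \<longrightarrow> x v = 0) \<and> (\<forall>f. f \<notin> E \<longrightarrow> y f = 0) \<and> (\<forall>S. 0 \<le> slack a b x y S) \<and>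
     sum x UNIV + sum y UNIV = n"
  by (auto simp: level_def cone_points_def)

lemma edge_term_le_abs: "edge_term a b S f (y::int) \<le> \<bar>y\<bar>"
  by (cases "y \<ge> 0") (auto simp: edge_term_nonneg edge_term_nonpos of_bool_def)

text \<open>For \<open>S = UNIV\<close> each edge contributes \<open>min 0 (2 * y f)\<close>, that
  is \<open>y f - \<bar>y f\<bar>\<close>, so this single inequality suffices.\<close>

lemma sum_abs_le_level:
  assumes "\<And>S. 0 \<le> slack a b x y S"
  shows "(\<Sum>f\<in>UNIV. \<bar>y f\<bar>) \<le> sum x UNIV + sum y UNIV"
proof -
  have "edge_term a b UNIV f (y f) = y f - \<bar>y f\<bar>" for f
    by (cases "y f \<ge> 0") (auto simp: edge_term_nonneg edge_term_nonpos)
  then show ?thesis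
    using assms[of UNIV] by (simp add: slack_def sum_subtractf)
qed

text \<open>Crude bounds, enough for finiteness and for level 0. The lower one comes from the set
  \<open>{v}\<close>, the upper one from the lower bounds at all other vertices.\<close>

lemma level_bounds:
  fixes x :: "'v::finite \<Rightarrow> int" and y :: "'e::finite \<Rightarrow> int"
  assumes "(x, y) \<in> level V E a b n"
  shows "\<bar>y f\<bar> \<le> n" "- n \<le> x v" "x v \<le> n + n + int CARD('v) * n"
proof -
  have nn: "0 \<le> slack a b x y S" for S
    using assms by (auto simp: level_iff)
  have n: "sum x UNIV + sum y UNIV = n"
    using assms by (auto simp: level_iff)
  have ys: "(\<Sum>f\<in>UNIV. \<bar>y f\<bar>) \<le> n"
    using sum_abs_le_level[OF nn] n by simp
  show "\<bar>y f\<bar> \<le> n"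
    using member_le_sum[of f UNIV "\<lambda>f. \<bar>y f\<bar>"] ys by simp
  have lo: "- n \<le> x v" for v
  proof -
    have "(\<Sum>f\<in>UNIV. edge_term a b {v} f (y f)) \<le> (\<Sum>f\<in>UNIV. \<bar>y f\<bar>)"
      by (intro sum_mono edge_term_le_abs)
    then show ?thesis using nn[of "{v}"] ys by (simp add: slack_def)
  qed
  then show "- n \<le> x v" .
  have "n \<ge> 0" by (rule order_trans[OF sum_nonneg ys]) simp
  have "- (int CARD('v) * n) \<le> - (int (card (UNIV - {v})) * n)"
    using \<open>n \<ge> 0\<close> by (simp add: mult_right_mono card_mono)
  also have "\<dots> \<le> sum x (UNIV - {v})"
    using sum_bounded_below[of "UNIV - {v}" "- n" x] lo by simp
  finally have "- (int CARD('v) * n) \<le> sum x (UNIV - {v})" .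
  moreover have "sum x UNIV = x v + sum x (UNIV - {v})"
    by (rule sum.remove) auto
  moreover have "- sum y UNIV \<le> n"
    using ys sum_abs[of y UNIV] by linarith
  ultimately show "x v \<le> n + n + int CARD('v) * n"
    using n by linarith
qed

lemma finite_funs_bounded: "finite {x :: 'a::finite \<Rightarrow> int. \<forall>v. l \<le> x v \<and> x v \<le> u}"
proof -
  have "{x :: 'a \<Rightarrow> int. \<forall>v. l \<le> x v \<and> x v \<le> u} = PiE UNIV (\<lambda>_. {l..u})"
    by (auto simp: PiE_def)
  then show ?thesis by (simp add: finite_PiE)
qed

lemma finite_level: "finite (level V E a b n)"
  for V :: "'v::finite set" and E :: "'e::finite set"
proof (rule finite_subset)
  show "level V E a b n \<subseteq> {x. \<forall>v. - n \<le> x v \<and> x v \<le> n + n + int CARD('v) * n}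
      \<times> {y. \<forall>f. - n \<le> y f \<and> y f \<le> n}"
  proof (rule subrelI)
    fix x y assume xy: "(x, y) \<in> level V E a b n"
    have "- n \<le> y f" "y f \<le> n" for f
      using level_bounds(1)[OF xy, of f] by linarith+
    then show "(x, y) \<in> {x. \<forall>v. - n \<le> x v \<and> x v \<le> n + n + int CARD('v) * n}
      \<times> {y. \<forall>f. - n \<le> y f \<and> y f \<le> n}"
      using level_bounds(2,3)[OF xy] by blast
  qed
qed (intro finite_cartesian_product finite_funs_bounded)

text \<open>The translation of \<open>neg_slice\<close> adds \<open>2 * m\<close> to the vertex sum
  and takes \<open>m\<close> from the edge sum, hence the level \<open>n + m\<close>. For a loop
  both shares fall on the same vertex.\<close>

lemma card_neg_slice:
  fixes V :: "'v::finite set" and E :: "'e::finite set"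
  assumes e: "e \<in> E" and V: "a e \<in> V" "b e \<in> V" and m: "m \<le> 0"
  shows "card {p \<in> level V E a b n. snd p e = m} = card (level V (E - {e}) a b (n + m))"
proof (rule bij_betw_same_card)
  let ?d = "\<lambda>v. of_bool (v = a e) + of_bool (v = b e) :: int"
  have sd: "(\<Sum>v\<in>UNIV. ?d v) = 2"
    using sum_mult_of_bool_eq[of 1 "a e" UNIV] sum_mult_of_bool_eq[of 1 "b e" UNIV]
    by (simp add: sum.distrib)
  show "bij_betw (\<lambda>(x, y). (\<lambda>v. x v + m * ?d v, y(e := 0)))
      {p \<in> level V E a b n. snd p e = m} (level V (E - {e}) a b (n + m))"
  proof (rule bij_betw_byWitness[where f' = "\<lambda>(x, y). (\<lambda>v. x v - m * ?d v, y(e := m))"])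
    show "(\<lambda>(x, y). (\<lambda>v. x v + m * ?d v, y(e := 0))) ` {p \<in> level V E a b n. snd p e = m}
        \<subseteq> level V (E - {e}) a b (n + m)"
    proof clarify
      fix x y assume xy: "(x, y) \<in> level V E a b n" and ye: "m = snd (x, y) e"
      have "slack a b x y S = slack a b (\<lambda>v. x v + m * ?d v) (y(e := 0)) S" for S
        using neg_slice[of y e a b x S] m ye by simp
      then show "(\<lambda>v. x v + snd (x, y) e * ?d v, y(e := 0)) \<in> level V (E - {e}) a b (n + snd (x, y) e)"
        using xy e V ye
        by (auto simp: level_iff sum.distrib sum_distrib_left[symmetric] sd sum_fun_upd_UNIV)
    qed
    show "(\<lambda>(x, y). (\<lambda>v. x v - m * ?d v, y(e := m))) ` level V (E - {e}) a b (n + m)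
        \<subseteq> {p \<in> level V E a b n. snd p e = m}"
    proof clarify
      fix x y assume xy: "(x, y) \<in> level V (E - {e}) a b (n + m)"
      then have ye: "y(e := 0) = y" by (auto simp: level_iff)
      have "slack a b (\<lambda>v. x v - m * ?d v) (y(e := m)) S = slack a b x y S" for S
        using neg_slice[of "y(e := m)" e a b "\<lambda>v. x v - m * ?d v" S] m ye by simp
      then show "(\<lambda>v. x v - m * ?d v, y(e := m)) \<in> level V E a b n \<and> snd (\<lambda>v. x v - m * ?d v, y(e := m)) e = m"
        using xy e V
        by (auto simp: level_iff sum_subtractf sum_distrib_left[symmetric] sd sum_fun_upd_UNIV)
    qed
  qed (auto simp: level_iff fun_eq_iff)
qed

text \<open>No set separates the ends of a loop, so a nonnegative weight on it is
  unconstrained.\<close>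

lemma card_loop_slice:
  fixes V :: "'v::finite set" and E :: "'e::finite set"
  assumes e: "e \<in> E" and ab: "a e = b e" and m: "m \<ge> 0"
  shows "card {p \<in> level V E a b n. snd p e = m} = card (level V (E - {e}) a b (n - m))"
proof (rule bij_betw_same_card)
  show "bij_betw (\<lambda>(x, y). (x, y(e := 0)))
      {p \<in> level V E a b n. snd p e = m} (level V (E - {e}) a b (n - m))"
  proof (rule bij_betw_byWitness[where f' = "\<lambda>(x, y). (x, y(e := m))"])
    show "(\<lambda>(x, y). (x, y(e := 0))) ` {p \<in> level V E a b n. snd p e = m}
        \<subseteq> level V (E - {e}) a b (n - m)"
    proof clarify
      fix x y assume xy: "(x, y) \<in> level V E a b n" and ye: "m = snd (x, y) e"
      have "slack a b x y S = slack a b x (y(e := 0)) S" for S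
        using loop_slice[of a e b y x S] m ye ab by simp
      then show "(x, y(e := 0)) \<in> level V (E - {e}) a b (n - snd (x, y) e)"
        using xy e ye by (auto simp: level_iff sum_fun_upd_UNIV)
    qed
    show "(\<lambda>(x, y). (x, y(e := m))) ` level V (E - {e}) a b (n - m)
        \<subseteq> {p \<in> level V E a b n. snd p e = m}"
    proof clarify
      fix x y assume xy: "(x, y) \<in> level V (E - {e}) a b (n - m)"
      then have ye: "y(e := 0) = y" by (auto simp: level_iff)
      have "slack a b x (y(e := m)) S = slack a b x y S" for S
        using loop_slice[of a e b "y(e := m)" x S] m ye ab by simp
      then show "(x, y(e := m)) \<in> level V E a b n \<and> snd (x, y(e := m)) e = m"
        using xy e by (auto simp: level_iff sum_fun_upd_UNIV)
    qed
  qed (auto simp: level_iff fun_eq_iff)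
qed

section \<open>Contraction of an edge and the lines in its direction\<close>

definition glue :: "'v \<Rightarrow> 'v \<Rightarrow> 'v \<Rightarrow> 'v" where
  "glue i j v = (if v = j then i else v)"

text \<open>Vertex sets of the contraction correspond to sets that do not separate \<open>i\<close>
  and \<open>j\<close>. Since \<open>q j = 0\<close>, it does not matter whether the discarded
  vertex is counted.\<close>

lemma slack_glue:
  fixes q :: "'v::finite \<Rightarrow> int"
  assumes "q j = 0" "i \<noteq> j"
  shows "slack (glue i j \<circ> a) (glue i j \<circ> b) q y S = slack a b q y {v. glue i j v \<in> S}"
proof -
  have "sum q {v. glue i j v \<in> S} = sum q S"
    using assms by (intro sum.mono_neutral_cong) (auto simp: glue_def split: if_splits)
  then show ?thesis
    by (simp add: slack_def edge_term_def)
qed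

text \<open>Each line in direction e_j - e_i has exactly one point with coordinate 0 at
  \<open>b e\<close>, so \<open>q\<close> stands for a whole line. From right to left, shifts leave
  the slack of non-separating sets unchanged.\<close>

lemma contraction_iff:
  fixes q :: "'v::finite \<Rightarrow> int" and y :: "'e::finite \<Rightarrow> int"
  assumes ij: "a e \<noteq> b e" and q: "q (b e) = 0" and y: "y e = 0"
  shows "(\<forall>S. 0 \<le> slack (glue (a e) (b e) \<circ> a) (glue (a e) (b e) \<circ> b) q y S) \<longleftrightarrow>
     (\<exists>c. \<forall>S. 0 \<le> slack a b (shift (a e) (b e) c q) y S)" (is "?L \<longleftrightarrow> ?R")
proof
  assume L: ?L
  txt \<open>With a weight on \<open>e\<close> this large, only the sets not separating the endpoints of \<open>e\<close>
    give a constraint.\<close>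
  define B where "B = (\<Sum>S\<in>UNIV. \<bar>slack a b q y S\<bar>)"
  have "B \<ge> 0" by (simp add: B_def sum_nonneg)
  have "0 \<le> slack a b q (y(e := B)) S" for S
  proof (cases "(a e \<in> S) = (b e \<in> S)")
    case True
    then have "{v. glue (a e) (b e) v \<in> S} = S" by (auto simp: glue_def)
    then have "0 \<le> slack a b q y S"
      using L slack_glue[of q "b e" "a e" a b y S] q ij by metis
    then show ?thesis
      using True \<open>B \<ge> 0\<close> y by (simp add: slack_fun_upd edge_term_nonneg)
  next
    case False
    have "\<bar>slack a b q y S\<bar> \<le> B"
      unfolding B_def by (rule member_le_sum) auto
    then show ?thesis
      using False \<open>B \<ge> 0\<close> y by (simp add: slack_fun_upd edge_term_nonneg)
  qed
  \<comment> \<open>\<open>nonneg_slice_iff\<close> trades the weight \<open>B\<close> for a shift;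
    the bound on the size of the shift is dropped.\<close>
  then have "\<exists>c. \<forall>S. 0 \<le> slack a b (shift (a e) (b e) c q) ((y(e := B))(e := 0)) S"
    using nonneg_slice_iff[of a e b "y(e := B)" q] ij \<open>B \<ge> 0\<close> by auto
  moreover have "(y(e := B))(e := 0) = y" using y by auto
  ultimately show ?R by simp
next
  assume ?R
  then obtain c where c: "\<And>S. 0 \<le> slack a b (shift (a e) (b e) c q) y S" by blast
  have "0 \<le> slack a b q y {v. glue (a e) (b e) v \<in> S}" for S
    using c[of "{v. glue (a e) (b e) v \<in> S}"] by (simp add: slack_shift glue_def)
  then show ?L
    using slack_glue[of q "b e" "a e" a b y] q ij by simp
qed

definition fibre :: "'a set \<Rightarrow> (int \<Rightarrow> 'a) \<Rightarrow> int set" where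
  "fibre A f = {c. f c \<in> A}"

text \<open>A nonempty integer interval grows by \<open>m\<close> at each end, whereas an empty one
  would stay empty.\<close>

lemma card_thicken:
  fixes I :: "int set"
  assumes "finite I" "I \<noteq> {}" "m \<ge> 0"
    and conv: "\<And>c d u. c \<in> I \<Longrightarrow> d \<in> I \<Longrightarrow> c \<le> u \<Longrightarrow> u \<le> d \<Longrightarrow> u \<in> I"
  shows "card {d. \<exists>c. \<bar>c\<bar> \<le> m \<and> d + c \<in> I} = card I + 2 * nat m"
    and "finite {d. \<exists>c. \<bar>c\<bar> \<le> m \<and> d + c \<in> I}"
proof -
  obtain l u where lu: "I = {l..u}" "l \<le> u"
  proof (rule that[of "Min I" "Max I"])
    show "I = {Min I..Max I}"
    proof
      show "I \<subseteq> {Min I..Max I}"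
        using assms(1) by auto
      show "{Min I..Max I} \<subseteq> I"
        using conv[OF Min_in[OF assms(1,2)] Max_in[OF assms(1,2)]] by auto
    qed
    show "Min I \<le> Max I"
      using assms(1,2) by simp
  qed
  have "{d. \<exists>c. \<bar>c\<bar> \<le> m \<and> d + c \<in> I} = {l - m..u + m}" (is "?A = ?B")
  proof (intro set_eqI iffI)
    fix d assume "d \<in> ?A"
    then show "d \<in> ?B" using lu by (clarsimp simp: abs_le_iff)
  next
    fix d assume d: "d \<in> ?B"
    consider "d < l" | "d > u" | "d \<in> I" using lu by force
    then show "d \<in> ?A"
    proof cases
      case 1
      then have "\<bar>l - d\<bar> \<le> m \<and> d + (l - d) \<in> I" using d lu by simp
      then show ?thesis by blast
    next
      case 2
      then have "\<bar>u - d\<bar> \<le> m \<and> d + (u - d) \<in> I" using d lu by simp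
      then show ?thesis by blast
    next
      case 3
      then have "\<bar>0\<bar> \<le> m \<and> d + 0 \<in> I" using \<open>m \<ge> 0\<close> by simp
      then show ?thesis by blast
    qed
  qed
  then show "card {d. \<exists>c. \<bar>c\<bar> \<le> m \<and> d + c \<in> I} = card I + 2 * nat m"
    "finite {d. \<exists>c. \<bar>c\<bar> \<le> m \<and> d + c \<in> I}"
    using lu \<open>m \<ge> 0\<close> by simp_all
qed

context
  fixes V :: "'v::finite set" and E :: "'e::finite set" and a b :: "'e \<Rightarrow> 'v" and e :: 'e
  assumes e: "e \<in> E" and V: "a e \<in> V" "b e \<in> V" and ij: "a e \<noteq> b e"
begin

abbreviation (input) "sh \<equiv> shift (a e) (b e)"
abbreviation (input) "contr \<equiv> level (V - {b e}) (E - {e}) (glue (a e) (b e) \<circ> a) (glue (a e) (b e) \<circ> b)"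

lemma contr_iff:
  "(q, y) \<in> contr n \<longleftrightarrow> q (b e) = 0 \<and> (\<exists>c. (sh c q, y) \<in> level V (E - {e}) a b n)"
proof -
  have "(\<exists>c. (sh c q, y) \<in> level V (E - {e}) a b n) \<longleftrightarrow>
     (\<forall>v. v \<notin> V \<longrightarrow> q v = 0) \<and> (\<forall>f. f \<notin> E - {e} \<longrightarrow> y f = 0) \<and>
     (\<exists>c. \<forall>S. 0 \<le> slack a b (sh c q) y S) \<and> sum q UNIV + sum y UNIV = n"
  proof -
    have "(\<forall>v. v \<notin> V \<longrightarrow> sh c q v = 0) \<longleftrightarrow> (\<forall>v. v \<notin> V \<longrightarrow> q v = 0)" for c
      using shift_outside[OF V, of _ c q] by metis
    then show ?thesis by (simp only: level_iff sum_shift_UNIV ex_simps)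
  qed
  moreover have "(q, y) \<in> contr n \<longleftrightarrow>
     q (b e) = 0 \<and> (\<forall>v. v \<notin> V \<longrightarrow> q v = 0) \<and> (\<forall>f. f \<notin> E - {e} \<longrightarrow> y f = 0) \<and>
     (\<forall>S. 0 \<le> slack (glue (a e) (b e) \<circ> a) (glue (a e) (b e) \<circ> b) q y S) \<and> sum q UNIV + sum y UNIV = n"
  proof -
    have "(\<forall>v. v \<notin> V - {b e} \<longrightarrow> q v = 0) \<longleftrightarrow> q (b e) = 0 \<and> (\<forall>v. v \<notin> V \<longrightarrow> q v = 0)"
      by auto
    then show ?thesis by (simp only: level_iff conj_assoc)
  qed
  moreover have "(\<exists>c. \<forall>S. 0 \<le> slack a b (sh c q) y S) \<longleftrightarrow>
     (\<forall>S. 0 \<le> slack (glue (a e) (b e) \<circ> a) (glue (a e) (b e) \<circ> b) q y S)"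
    if "q (b e) = 0" "\<forall>f. f \<notin> E - {e} \<longrightarrow> y f = 0"
    by (rule contraction_iff[of a e b q y, OF ij that(1), symmetric]) (use that(2) in simp)
  ultimately show ?thesis by meson
qed

lemma nonneg_slice_level_iff:
  assumes "m \<ge> 0"
  shows "(x, y) \<in> level V E a b n \<and> y e = m \<longleftrightarrow>
    y e = m \<and> (\<exists>c. \<bar>c\<bar> \<le> m \<and> (sh c x, y(e := 0)) \<in> level V (E - {e}) a b (n - m))"
proof (cases "y e = m")
  case True
  have "(\<forall>S. 0 \<le> slack a b x y S) \<longleftrightarrow>
     (\<exists>c. \<bar>c\<bar> \<le> m \<and> (\<forall>S. 0 \<le> slack a b (sh c x) (y(e := 0)) S))"
    using nonneg_slice_iff[of a e b y x] ij True assms by simp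
  moreover have "(\<forall>v. v \<notin> V \<longrightarrow> sh c x v = 0) \<longleftrightarrow> (\<forall>v. v \<notin> V \<longrightarrow> x v = 0)" for c
    by (simp add: shift_outside[OF V] cong: imp_cong)
  moreover have "(\<forall>f. f \<notin> E - {e} \<longrightarrow> (y(e := 0)) f = 0) \<longleftrightarrow> (\<forall>f. f \<notin> E \<longrightarrow> y f = 0)"
    using e by auto
  moreover have "sum x UNIV + sum (y(e := 0)) UNIV = n - m \<longleftrightarrow> sum x UNIV + sum y UNIV = n"
    using True by (auto simp: sum_fun_upd_UNIV)
  ultimately show ?thesis
    using True by (auto simp only: level_iff sum_shift_UNIV)
qed auto

abbreviation (input) "line n \<equiv> \<lambda>(q, y). fibre (level V (E - {e}) a b n) (\<lambda>c. (sh c q, y))"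

text \<open>For fixed \<open>S\<close> the slack is affine in the parameter, so nonnegativity at two
  parameters extends to those between. The parameter is read off at the coordinate
  \<open>b e\<close>, which gives finiteness.\<close>

lemma fibre_interval:
  assumes "p \<in> contr n"
  shows "finite (line n p)" "line n p \<noteq> {}"
    "\<And>c d u. c \<in> line n p \<Longrightarrow> d \<in> line n p \<Longrightarrow> c \<le> u \<Longrightarrow> u \<le> d \<Longrightarrow> u \<in> line n p"
proof -
  obtain q y where p: "p = (q, y)" by (cases p)
  have inj: "inj (\<lambda>c. (sh c q, y))"
  proof (rule injI)
    fix c d assume "(sh c q, y) = (sh d q, y)"
    then have "sh c q (b e) = sh d q (b e)" by simp
    then show "c = d" using ij by (simp add: shift_at)
  qed
  show "finite (line n p)"
    using finite_vimageI[OF finite_level[of V "E - {e}" a b n] inj]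
    by (simp add: p fibre_def vimage_def)
  show "line n p \<noteq> {}"
    using assms by (auto simp: p fibre_def contr_iff)
  fix c d u assume cd: "c \<in> line n p" "d \<in> line n p" "c \<le> u" "u \<le> d"
  have "0 \<le> slack a b (sh u q) y S" for S
  proof -
    have "0 \<le> slack a b (sh c q) y S" "0 \<le> slack a b (sh d q) y S"
      using cd by (auto simp: p fibre_def level_iff)
    then show ?thesis
      using cd(3,4) by (cases "a e \<in> S"; cases "b e \<in> S") (auto simp: slack_shift)
  qed
  moreover have "sh u q v = 0" if "v \<notin> V" for v
    using that cd(1) by (auto simp: p fibre_def level_iff shift_outside[OF V])
  ultimately show "u \<in> line n p"
    using cd(1) by (auto simp: p fibre_def level_iff)
qed

text \<open>A point of the slice is encoded by the point of its line with coordinate 0 at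
  \<open>b e\<close> and by the parameter \<open>d = x (b e)\<close>, which ranges over the
  thickened interval of that line.\<close>

lemma card_nonneg_slice_sum:
  assumes "m \<ge> 0"
  shows "card {p \<in> level V E a b n. snd p e = m} =
     (\<Sum>p\<in>contr (n - m). card (line (n - m) p) + 2 * nat m)"
proof -
  let ?T = "\<lambda>p. {d. \<exists>c. \<bar>c\<bar> \<le> m \<and> d + c \<in> line (n - m) p}"
  have thick: "card (?T p) = card (line (n - m) p) + 2 * nat m" "finite (?T p)"
    if p: "p \<in> contr (n - m)" for p
    using card_thicken[OF fibre_interval(1)[OF p] fibre_interval(2)[OF p] assms fibre_interval(3)[OF p]]
    by simp_all
  have "bij_betw (\<lambda>(x, y). ((sh (- x (b e)) x, y(e := 0)), x (b e)))
     {p \<in> level V E a b n. snd p e = m} (Sigma (contr (n - m)) ?T)"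
  proof (rule bij_betw_byWitness[where f' = "\<lambda>((q, y), d). (sh d q, y(e := m))"])
    have "((sh (- x (b e)) x, y(e := 0)), x (b e)) \<in> Sigma (contr (n - m)) ?T"
      if xy: "(x, y) \<in> level V E a b n" "y e = m" for x y
    proof -
      obtain c where c: "\<bar>c\<bar> \<le> m" "(sh c x, y(e := 0)) \<in> level V (E - {e}) a b (n - m)"
        using xy nonneg_slice_level_iff[OF assms] by blast
      have "(sh (c + x (b e)) (sh (- x (b e)) x), y(e := 0)) \<in> level V (E - {e}) a b (n - m)"
        using c(2) by simp
      moreover have "sh (- x (b e)) x (b e) = 0" using ij by (simp add: shift_at)
      ultimately have "(sh (- x (b e)) x, y(e := 0)) \<in> contr (n - m)"
        unfolding contr_iff by blast
      then show ?thesis using c by (auto simp: fibre_def add.commute intro!: exI[of _ c])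
    qed
    then show "(\<lambda>(x, y). ((sh (- x (b e)) x, y(e := 0)), x (b e))) ` {p \<in> level V E a b n. snd p e = m}
       \<subseteq> Sigma (contr (n - m)) ?T" by auto
    have "(sh d q, y(e := m)) \<in> level V E a b n"
      if d: "d \<in> ?T (q, y)" for q y d
    proof -
      obtain c where c: "\<bar>c\<bar> \<le> m" "(sh (d + c) q, y) \<in> level V (E - {e}) a b (n - m)"
        using d by (auto simp: fibre_def)
      have "y(e := 0) = y" using c(2) by (auto simp: level_iff)
      then have "(sh c (sh d q), (y(e := m))(e := 0)) \<in> level V (E - {e}) a b (n - m)"
        using c(2) by (simp add: add.commute)
      then show ?thesis
        using nonneg_slice_level_iff[OF assms, of "sh d q" "y(e := m)" n] c(1) by auto
    qed
    then show "(\<lambda>((q, y), d). (sh d q, y(e := m))) ` Sigma (contr (n - m)) ?T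
       \<subseteq> {p \<in> level V E a b n. snd p e = m}" by auto
    show "\<forall>p\<in>Sigma (contr (n - m)) ?T. (\<lambda>(x, y). ((sh (- x (b e)) x, y(e := 0)), x (b e)))
       ((\<lambda>((q, y), d). (sh d q, y(e := m))) p) = p"
    proof
      fix p assume "p \<in> Sigma (contr (n - m)) ?T"
      then obtain q y d where p: "p = ((q, y), d)" and "(q, y) \<in> contr (n - m)"
        by auto
      then have "q (b e) = 0" "y(e := 0) = y"
        by (auto simp: level_iff)
      moreover then have "sh d q (b e) = d" using ij by (simp add: shift_at)
      ultimately show "(\<lambda>(x, y). ((sh (- x (b e)) x, y(e := 0)), x (b e)))
       ((\<lambda>((q, y), d). (sh d q, y(e := m))) p) = p" by (simp add: p)
    qed
  qed auto
  then have "card {p \<in> level V E a b n. snd p e = m} = card (Sigma (contr (n - m)) ?T)"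
    by (rule bij_betw_same_card)
  also have "\<dots> = (\<Sum>p\<in>contr (n - m). card (?T p))"
    using thick(2) by (intro card_SigmaI finite_level) blast
  also have "\<dots> = (\<Sum>p\<in>contr (n - m). card (line (n - m) p) + 2 * nat m)"
    by (intro sum.cong refl thick(1))
  finally show ?thesis .
qed

lemma card_nonneg_slice:
  assumes "m \<ge> 0"
  shows "card {p \<in> level V E a b n. snd p e = m} =
     card (level V (E - {e}) a b (n - m)) + 2 * nat m * card (contr (n - m))"
proof -
  \<comment> \<open>The case \<open>m = 0\<close> of the same count: the lengths of the lines add up
    to the number of points of the deletion.\<close>
  have "{p \<in> level V E a b (n - m). snd p e = 0} = level V (E - {e}) a b (n - m)"
    using e by (auto simp: level_iff)
  then have "card (level V (E - {e}) a b (n - m)) = (\<Sum>p\<in>contr (n - m). card (line (n - m) p))"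
    using card_nonneg_slice_sum[of 0 "n - m"] by simp
  then show ?thesis
    by (simp add: card_nonneg_slice_sum[OF assms] sum.distrib)
qed

end

section \<open>Deletion and contraction for the Hilbert series\<close>

text \<open>Deletion can isolate a vertex \<open>v\<close>. The series below then still counts points with a positive
  coordinate at \<open>v\<close>, which are not in the cone over the polytope of the smaller graph.\<close>

definition hilb :: "'v::finite set \<Rightarrow> 'e::finite set \<Rightarrow> ('e \<Rightarrow> 'v) \<Rightarrow> ('e \<Rightarrow> 'v) \<Rightarrow> real fps" where
  "hilb V E a b = Abs_fps (\<lambda>n. of_nat (card (level V E a b (int n))))"

lemma sum_symmetric_interval:
  fixes F :: "int \<Rightarrow> nat"
  shows "(\<Sum>m\<in>{- int n..int n}. F m) = (\<Sum>k=0..n. F (int k) + (if k = 0 then 0 else F (- int k)))"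
proof -
  have "{- int n..int n} = int ` {0..n} \<union> (\<lambda>k. - int k) ` {1..n}"
  proof (intro set_eqI iffI)
    fix m assume m: "m \<in> {- int n..int n}"
    show "m \<in> int ` {0..n} \<union> (\<lambda>k. - int k) ` {1..n}"
    proof (cases "m \<ge> 0")
      case True
      then show ?thesis using m by (intro UnI1 image_eqI[of _ _ "nat m"]) auto
    next
      case False
      then show ?thesis using m by (intro UnI2 image_eqI[of _ _ "nat (- m)"]) auto
    qed
  qed auto
  moreover have "int ` {0..n} \<inter> (\<lambda>k. - int k) ` {1..n} = {}" by auto
  ultimately have "(\<Sum>m\<in>{- int n..int n}. F m) = (\<Sum>m\<in>int ` {0..n}. F m) + (\<Sum>m\<in>(\<lambda>k. - int k) ` {1..n}. F m)"
    by (simp add: sum.union_disjoint)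
  also have "\<dots> = (\<Sum>k=0..n. F (int k)) + (\<Sum>k=1..n. F (- int k))"
    by (simp add: sum.reindex inj_on_def)
  also have "(\<Sum>k=1..n. F (- int k)) = (\<Sum>k=0..n. if k = 0 then 0 else F (- int k))"
    by (rule sum.mono_neutral_cong_left) auto
  finally show ?thesis by (simp add: sum.distrib)
qed

lemma card_level_slices:
  fixes E :: "'e::finite set"
  shows "card (level V E a b (int n)) =
     (\<Sum>k=0..n. card {p \<in> level V E a b (int n). snd p e = int k}
        + (if k = 0 then 0 else card {p \<in> level V E a b (int n). snd p e = - int k}))"
proof -
  have "(\<lambda>p. snd p e) ` level V E a b (int n) \<subseteq> {- int n..int n}"
  proof
    fix m assume "m \<in> (\<lambda>p. snd p e) ` level V E a b (int n)"
    then obtain x y where xy: "(x, y) \<in> level V E a b (int n)" "m = y e" by auto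
    show "m \<in> {- int n..int n}"
      using level_bounds(1)[OF xy(1), of e] xy(2) by (simp add: abs_le_iff)
  qed
  from sum.group[OF finite_level finite_atLeastAtMost_int this, of "\<lambda>_. 1::nat"]
  have "card (level V E a b (int n)) = (\<Sum>m\<in>{- int n..int n}. card {p \<in> level V E a b (int n). snd p e = m})"
    by simp
  then show ?thesis by (simp only: sum_symmetric_interval)
qed

text \<open>For a loop this is the whole factor. For a non-loop it accounts for the deletion in the
  slices of both signs, and \<open>linear_series\<close> for the gain of the lines in the
  nonnegative slices.\<close>

abbreviation (input) loop_series :: "real fps" where
  "loop_series \<equiv> Abs_fps (\<lambda>k. if k = 0 then 1 else 2)"

abbreviation (input) linear_series :: "real fps" where
  "linear_series \<equiv> Abs_fps (\<lambda>k. 2 * real k)"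

lemma fps_mult_one_minus_X_nth:
  fixes f :: "real fps"
  shows "fps_nth (f * (1 - fps_X)) n = fps_nth f n - (if n = 0 then 0 else fps_nth f (n - 1))"
  by (simp add: right_diff_distrib)

lemma loop_series: "loop_series * (1 - fps_X) = 1 + fps_X"
  by (rule fps_ext) (auto simp: fps_mult_one_minus_X_nth)

lemma linear_series: "linear_series * (1 - fps_X)\<^sup>2 = 2 * fps_X"
proof -
  have "linear_series * (1 - fps_X) = Abs_fps (\<lambda>k. if k = 0 then 0 else 2)"
  proof (rule fps_ext)
    fix n show "fps_nth (linear_series * (1 - fps_X)) n = fps_nth (Abs_fps (\<lambda>k. if k = 0 then 0 else 2)) n"
      by (cases n) (auto simp: fps_mult_one_minus_X_nth)
  qed
  moreover have "Abs_fps (\<lambda>k. if k = 0 then 0 else 2) * (1 - fps_X) = (2 * fps_X :: real fps)"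
  proof (rule fps_ext)
    fix n show "fps_nth (Abs_fps (\<lambda>k. if k = 0 then 0 else 2) * (1 - fps_X)) n = fps_nth (2 * fps_X :: real fps) n"
      by (cases n) (auto simp: fps_mult_one_minus_X_nth fps_numeral_fps_const)
  qed
  ultimately show ?thesis by (simp add: power2_eq_square mult.assoc[symmetric])
qed

lemma hilb_loop:
  assumes e: "e \<in> E" and V: "b e \<in> V" and ab: "a e = b e"
  shows "hilb V E a b = loop_series * hilb V (E - {e}) a b"
proof (rule fps_ext)
  fix n
  have pos: "card {p \<in> level V E a b (int n). snd p e = int k} = card (level V (E - {e}) a b (int (n - k)))"
    if "k \<le> n" for k
    using card_loop_slice[of e E a b "int k" V "int n"] e ab that by (simp add: of_nat_diff)
  have neg: "card {p \<in> level V E a b (int n). snd p e = - int k} = card (level V (E - {e}) a b (int (n - k)))"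
    if "k \<le> n" for k
    using card_neg_slice[of e E a V b "- int k" "int n"] e V ab that by (simp add: of_nat_diff)
  have "card (level V E a b (int n)) =
      (\<Sum>k=0..n. (if k = 0 then 1 else 2) * card (level V (E - {e}) a b (int (n - k))))"
    by (subst card_level_slices[of _ _ _ _ _ e]) (intro sum.cong refl, simp add: pos neg)
  then show "fps_nth (hilb V E a b) n = fps_nth (loop_series * hilb V (E - {e}) a b) n"
    by (auto simp: hilb_def fps_mult_nth intro!: sum.cong)
qed

lemma hilb_nonloop:
  assumes e: "e \<in> E" and V: "a e \<in> V" "b e \<in> V" and ab: "a e \<noteq> b e"
  shows "hilb V E a b = loop_series * hilb V (E - {e}) a b +
     linear_series * hilb (V - {b e}) (E - {e}) (glue (a e) (b e) \<circ> a) (glue (a e) (b e) \<circ> b)"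
proof (rule fps_ext)
  fix n
  let ?B = "level (V - {b e}) (E - {e}) (glue (a e) (b e) \<circ> a) (glue (a e) (b e) \<circ> b)"
  have pos: "card {p \<in> level V E a b (int n). snd p e = int k} =
      card (level V (E - {e}) a b (int (n - k))) + 2 * k * card (?B (int (n - k)))"
    if "k \<le> n" for k
    using card_nonneg_slice[of e E a V b "int k" "int n"] e V ab that by (simp add: of_nat_diff)
  have neg: "card {p \<in> level V E a b (int n). snd p e = - int k} = card (level V (E - {e}) a b (int (n - k)))"
    if "k \<le> n" for k
    using card_neg_slice[of e E a V b "- int k" "int n"] e V that by (simp add: of_nat_diff)
  have "card (level V E a b (int n)) =
      (\<Sum>k=0..n. (if k = 0 then 1 else 2) * card (level V (E - {e}) a b (int (n - k)))
        + 2 * k * card (?B (int (n - k))))"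
    by (subst card_level_slices[of _ _ _ _ _ e]) (intro sum.cong refl, simp add: pos neg)
  then have "real (card (level V E a b (int n))) =
      (\<Sum>k=0..n. (if k = 0 then 1 else 2) * real (card (level V (E - {e}) a b (int (n - k)))))
        + (\<Sum>k=0..n. 2 * real k * real (card (?B (int (n - k)))))"
    by (simp add: sum.distrib if_distrib[of real] cong: if_cong)
  then show "fps_nth (hilb V E a b) n = fps_nth (loop_series * hilb V (E - {e}) a b +
     linear_series * hilb (V - {b e}) (E - {e}) (glue (a e) (b e) \<circ> a) (glue (a e) (b e) \<circ> b)) n"
    by (simp add: hilb_def fps_mult_nth)
qed

section \<open>Edgeless graphs, the start of the recursion\<close>

lemma level_no_edges_iff:
  "(x, y) \<in> level V {} a b n \<longleftrightarrow>
     (\<forall>v. v \<notin> V \<longrightarrow> x v = 0) \<and> y = (\<lambda>_. 0) \<and> (\<forall>v. 0 \<le> x v) \<and> sum x UNIV = n"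
proof -
  have "(\<forall>S. 0 \<le> slack a b x (\<lambda>_. 0) S) \<longleftrightarrow> (\<forall>v. 0 \<le> x v)"
  proof
    assume s: "\<forall>S. 0 \<le> slack a b x (\<lambda>_. 0) S"
    show "\<forall>v. 0 \<le> x v"
    proof
      fix v show "0 \<le> x v" using s[rule_format, of "{v}"] by (simp add: slack_def)
    qed
  qed (simp add: slack_def sum_nonneg)
  moreover have "(\<forall>f. f \<notin> {} \<longrightarrow> y f = 0) \<longleftrightarrow> y = (\<lambda>_. 0)" by auto
  ultimately show ?thesis unfolding level_iff by auto
qed

lemma hilb_insert_vertex:
  fixes V :: "'v::finite set"
  assumes v: "v \<notin> V"
  shows "hilb (insert v V) {} a b = Abs_fps (\<lambda>_. 1) * hilb V {} a b"
proof (rule fps_ext)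
  fix n
  let ?L = "level (insert v V) {} a b (int n)"
  have range: "(\<lambda>p. fst p v) ` ?L \<subseteq> int ` {0..n}"
  proof
    fix m assume "m \<in> (\<lambda>p. fst p v) ` ?L"
    then obtain x y where "(x, y) \<in> ?L" and m: "m = x v" by auto
    then have x: "\<forall>v. 0 \<le> x v" "sum x UNIV = int n" by (auto simp: level_no_edges_iff)
    have "x v \<le> sum x UNIV" by (rule member_le_sum) (use x in auto)
    then show "m \<in> int ` {0..n}" using x m by (intro image_eqI[of _ _ "nat m"]) auto
  qed
  have slice: "card {p \<in> ?L. fst p v = int k} = card (level V {} a b (int (n - k)))" if "k \<le> n" for k
  proof (rule bij_betw_same_card)
    show "bij_betw (\<lambda>(x, y). (x(v := 0), y)) {p \<in> ?L. fst p v = int k} (level V {} a b (int (n - k)))"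
    proof (rule bij_betw_byWitness[where f' = "\<lambda>(x, y). (x(v := int k), y)"])
      show "\<forall>p\<in>level V {} a b (int (n - k)). (case case p of (x, y) \<Rightarrow> (x(v := int k), y) of (x, y) \<Rightarrow> (x(v := 0), y)) = p"
        using v by (auto simp: level_no_edges_iff)
      show "(\<lambda>(x, y). (x(v := 0), y)) ` {p \<in> ?L. fst p v = int k} \<subseteq> level V {} a b (int (n - k))"
        using that by (auto simp: level_no_edges_iff sum_fun_upd_UNIV of_nat_diff)
      show "(\<lambda>(x, y). (x(v := int k), y)) ` level V {} a b (int (n - k)) \<subseteq> {p \<in> ?L. fst p v = int k}"
        using that v by (auto simp: level_no_edges_iff sum_fun_upd_UNIV of_nat_diff)
    qed auto
  qed
  have "card ?L = (\<Sum>m\<in>int ` {0..n}. card {p \<in> ?L. fst p v = m})"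
    using sum.group[OF finite_level _ range, of "\<lambda>_. 1::nat"] by simp
  also have "\<dots> = (\<Sum>k=0..n. card (level V {} a b (int (n - k))))"
    by (simp add: sum.reindex slice)
  finally show "fps_nth (hilb (insert v V) {} a b) n = fps_nth (Abs_fps (\<lambda>_. 1) * hilb V {} a b) n"
    by (simp add: hilb_def fps_mult_nth)
qed

text \<open>The points form the nonnegative orthant, so every isolated vertex contributes a
  geometric series and the numerator is 1.\<close>

lemma hilb_no_edges: "hilb V {} a b * (1 - fps_X) ^ card V = 1"
  for V :: "'v::finite set" and a :: "'e::finite \<Rightarrow> 'v"
proof (induction V rule: finite_induct[OF finite])
  case 1
  have "level {} {} a b (int n) = (if n = 0 then {(\<lambda>_. 0, \<lambda>_. 0)} else {})" for n
  proof -
    have "(x, y) \<in> level {} {} a b (int n) \<longleftrightarrow> (x, y) \<in> (if n = 0 then {(\<lambda>_. 0, \<lambda>_. 0)} else {})" for x y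
      by (auto simp: level_no_edges_iff fun_eq_iff)
    then show ?thesis by (simp add: set_eq_iff split_paired_all)
  qed
  then show ?case by (intro fps_ext) (simp add: hilb_def)
next
  case (2 v V)
  have "Abs_fps (\<lambda>_. 1 :: real) * (1 - fps_X) = 1"
    by (rule fps_ext) (simp add: fps_mult_one_minus_X_nth)
  then have "Abs_fps (\<lambda>_. 1) * (1 - fps_X) * (hilb V {} a b * (1 - fps_X) ^ card V) = 1"
    using 2 by simp
  then show ?case using 2 by (simp add: hilb_insert_vertex algebra_simps)
qed

text \<open>Matches the constant term 1 that \<open>ehrhart_series\<close> has by
  definition.\<close>

lemma card_level_0: "card (level V E a b 0) = 1"
proof -
  have "level V E a b 0 = {(\<lambda>_. 0, \<lambda>_. 0)}"
  proof (intro set_eqI iffI)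
    fix p assume p: "p \<in> level V E a b 0"
    obtain x y where xy: "p = (x, y)" by (cases p)
    have "(x, y) \<in> level V E a b 0" using p xy by simp
    note bd = level_bounds[OF this]
    have "y f = 0" "x v = 0" for f v
      using bd(1)[of f] bd(2,3)[of v] by simp_all
    then show "p \<in> {(\<lambda>_. 0, \<lambda>_. 0)}" using xy by auto
  qed (auto simp: level_iff slack_def)
  then show ?thesis by simp
qed

section \<open>Connected components under deletion and contraction\<close>

definition adj :: "'e set \<Rightarrow> ('e \<Rightarrow> 'v) \<Rightarrow> ('e \<Rightarrow> 'v) \<Rightarrow> ('v \<times> 'v) set" where
  "adj E a b = {(u, v). \<exists>f\<in>E. (u = a f \<and> v = b f) \<or> (u = b f \<and> v = a f)}"

definition num_comps :: "'v set \<Rightarrow> 'e set \<Rightarrow> ('e \<Rightarrow> 'v) \<Rightarrow> ('e \<Rightarrow> 'v) \<Rightarrow> nat" where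
  "num_comps V E a b = card (V // {(u, v) \<in> V \<times> V. (u, v) \<in> (adj E a b)\<^sup>*})"

text \<open>The equality condition in a form that passes to deletions and contractions.\<close>

definition nonloops_are_bridges :: "'e set \<Rightarrow> ('e \<Rightarrow> 'v) \<Rightarrow> ('e \<Rightarrow> 'v) \<Rightarrow> bool" where
  "nonloops_are_bridges E a b \<longleftrightarrow> (\<forall>f\<in>E. a f \<noteq> b f \<longrightarrow> (a f, b f) \<notin> (adj (E - {f}) a b)\<^sup>*)"

lemma sym_adj_rtrancl: "(u, v) \<in> (adj E a b)\<^sup>* \<Longrightarrow> (v, u) \<in> (adj E a b)\<^sup>*"
  by (rule symD[OF sym_rtrancl]) (auto simp: sym_def adj_def)

lemma adj_mono: "E \<subseteq> F \<Longrightarrow> adj E a b \<subseteq> adj F a b"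
  by (auto simp: adj_def)

lemma adj_edge: "f \<in> E \<Longrightarrow> (a f, b f) \<in> adj E a b"
  by (auto simp: adj_def)

lemma card_image_eq_if_same_kernel:
  assumes "\<And>u v. u \<in> V \<Longrightarrow> v \<in> V \<Longrightarrow> f u = f v \<longleftrightarrow> h u = h v"
  shows "card (f ` V) = card (h ` V)"
proof (rule bij_betw_same_card)
  define g where "g = (\<lambda>y. h (inv_into V f y))"
  have g: "g (f v) = h v" if "v \<in> V" for v
    unfolding g_def using assms[of "inv_into V f (f v)" v] that
    by (metis f_inv_into_f imageI inv_into_into)
  show "bij_betw g (f ` V) (h ` V)"
    unfolding bij_betw_def
  proof
    show "inj_on g (f ` V)" using assms by (auto simp: inj_on_def g)
    show "g ` f ` V = h ` V" using g by (auto simp: image_image)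
  qed
qed

lemma adj_class_eq_iff:
  "(adj E a b)\<^sup>* `` {u} = (adj E a b)\<^sup>* `` {v} \<longleftrightarrow> (u, v) \<in> (adj E a b)\<^sup>*"
proof
  assume "(adj E a b)\<^sup>* `` {u} = (adj E a b)\<^sup>* `` {v}"
  then have "u \<in> (adj E a b)\<^sup>* `` {v}" by blast
  then show "(u, v) \<in> (adj E a b)\<^sup>*" using sym_adj_rtrancl by fast
next
  assume "(u, v) \<in> (adj E a b)\<^sup>*"
  then show "(adj E a b)\<^sup>* `` {u} = (adj E a b)\<^sup>* `` {v}"
    using sym_adj_rtrancl[of u v] by (auto intro: rtrancl_trans)
qed

text \<open>Counting the values of any function that distinguishes exactly the components lets
  different graphs be compared through a suitable choice of \<open>f\<close>.\<close>

lemma num_comps_eq_card_image: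
  assumes "\<And>u v. u \<in> V \<Longrightarrow> v \<in> V \<Longrightarrow> f u = f v \<longleftrightarrow> (u, v) \<in> (adj E a b)\<^sup>*"
  shows "num_comps V E a b = card (f ` V)"
proof -
  define R where "R = {(u, v) \<in> V \<times> V. (u, v) \<in> (adj E a b)\<^sup>*}"
  have eq: "R `` {u} = R `` {v} \<longleftrightarrow> (u, v) \<in> (adj E a b)\<^sup>*" if "u \<in> V" "v \<in> V" for u v
  proof -
    have R: "R `` {w} = V \<inter> (adj E a b)\<^sup>* `` {w}" if "w \<in> V" for w
      using that by (auto simp: R_def)
    show ?thesis
    proof
      assume "R `` {u} = R `` {v}"
      moreover have "v \<in> R `` {v}" using that by (simp add: R)
      ultimately show "(u, v) \<in> (adj E a b)\<^sup>*" using that by (auto simp: R)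
    qed (use that adj_class_eq_iff[of E a b u v] in \<open>simp add: R\<close>)
  qed
  have "num_comps V E a b = card ((\<lambda>v. R `` {v}) ` V)"
    by (auto simp: num_comps_def quotient_def R_def intro!: arg_cong[of _ _ card])
  also have "\<dots> = card (f ` V)"
    by (rule card_image_eq_if_same_kernel) (simp add: eq assms)
  finally show ?thesis .
qed

lemma num_comps_classes: "num_comps V E a b = card ((\<lambda>v. (adj E a b)\<^sup>* `` {v}) ` V)"
  by (rule num_comps_eq_card_image) (rule adj_class_eq_iff)

lemma num_comps_le: "finite V \<Longrightarrow> num_comps V E a b \<le> card V"
  unfolding num_comps_classes by (rule card_image_le)

lemma num_comps_no_edges: "num_comps V {} a b = card V"
  by (subst num_comps_eq_card_image[where f = "\<lambda>v. v"]) (auto simp: adj_def)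

lemma adj_remove:
  "e \<in> E \<Longrightarrow> adj E a b = insert (a e, b e) (insert (b e, a e) (adj (E - {e}) a b))"
  by (auto simp: adj_def)

lemma adj_rtrancl_remove_nonbridge:
  assumes "e \<in> E" "(a e, b e) \<in> (adj (E - {e}) a b)\<^sup>*"
  shows "(adj E a b)\<^sup>* = (adj (E - {e}) a b)\<^sup>*"
proof
  have "adj E a b \<subseteq> (adj (E - {e}) a b)\<^sup>*"
    using assms sym_adj_rtrancl[of "a e" "b e"] by (auto simp: adj_remove)
  then show "(adj E a b)\<^sup>* \<subseteq> (adj (E - {e}) a b)\<^sup>*"
    by (rule rtrancl_subset_rtrancl)
  show "(adj (E - {e}) a b)\<^sup>* \<subseteq> (adj E a b)\<^sup>*"
    by (intro rtrancl_mono adj_mono) auto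
qed

lemma num_comps_remove_nonbridge:
  assumes "e \<in> E" "(a e, b e) \<in> (adj (E - {e}) a b)\<^sup>*"
  shows "num_comps V (E - {e}) a b = num_comps V E a b"
  by (simp add: num_comps_def adj_rtrancl_remove_nonbridge[OF assms])

text \<open>A walk has to cross \<open>e\<close> at most once; the last two cases are the two
  directions of crossing.\<close>

lemma adj_rtrancl_remove_iff:
  fixes a b :: "'e \<Rightarrow> 'v"
  assumes e: "e \<in> E"
  defines "R \<equiv> (adj (E - {e}) a b)\<^sup>*"
  shows "(u, v) \<in> (adj E a b)\<^sup>* \<longleftrightarrow>
     (u, v) \<in> R \<or> (u, a e) \<in> R \<and> (b e, v) \<in> R \<or> (u, b e) \<in> R \<and> (a e, v) \<in> R" (is "?l \<longleftrightarrow> ?r u v")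
proof
  have sub: "R \<subseteq> (adj E a b)\<^sup>*"
    unfolding R_def by (intro rtrancl_mono adj_mono) auto
  have ab: "(a e, b e) \<in> (adj E a b)\<^sup>*" using adj_edge[OF e, of a b] by blast
  have ba: "(b e, a e) \<in> (adj E a b)\<^sup>*" by (rule sym_adj_rtrancl[OF ab])
  show "?l" if "?r u v"
    using that sub ab ba by (meson in_mono rtrancl_trans)
  show "?r u v" if "?l"
    using that
  proof (induction rule: rtrancl_induct)
    case base
    show ?case by (simp add: R_def)
  next
    case (step v w)
    have tr: "(x, y) \<in> R \<Longrightarrow> (y, z) \<in> R \<Longrightarrow> (x, z) \<in> R" for x y z
      unfolding R_def by (rule rtrancl_trans)
    have rf: "(x, x) \<in> R" for x unfolding R_def by simp
    have sy: "(x, y) \<in> R \<Longrightarrow> (y, x) \<in> R" for x y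
      unfolding R_def by (rule sym_adj_rtrancl)
    consider "(v, w) = (a e, b e)" | "(v, w) = (b e, a e)" | "(v, w) \<in> R"
      using step(2) unfolding adj_remove[OF e] R_def by blast
    then show ?case using step.IH tr rf sy by cases (metis Pair_inject)+
  qed
qed

lemma num_comps_remove_bridge:
  assumes e: "e \<in> E" and V: "finite V" "a e \<in> V" "b e \<in> V" and br: "(a e, b e) \<notin> (adj (E - {e}) a b)\<^sup>*"
  shows "num_comps V (E - {e}) a b = Suc (num_comps V E a b)"
proof -
  define R where "R = (adj (E - {e}) a b)\<^sup>*"
  define cl where "cl = (\<lambda>v. R `` {v})"
  \<comment> \<open>Merging the class of \<open>b e\<close> into that of \<open>a e\<close>
    distinguishes exactly the components of the graph with \<open>e\<close>, and only the class of
    \<open>b e\<close> is lost from the values.\<close>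
  define f where "f = (\<lambda>v. if (v, b e) \<in> R then cl (a e) else cl v)"
  have cl: "cl u = cl v \<longleftrightarrow> (u, v) \<in> R" for u v
    unfolding cl_def R_def by (rule adj_class_eq_iff)
  have rf: "(x, x) \<in> R" for x unfolding R_def by simp
  have sy: "(x, y) \<in> R \<longleftrightarrow> (y, x) \<in> R" for x y
    unfolding R_def using sym_adj_rtrancl by metis
  have "f u = f v \<longleftrightarrow> (u, v) \<in> (adj E a b)\<^sup>*" for u v
    unfolding adj_rtrancl_remove_iff[OF e] R_def[symmetric] f_def
    using cl sy by (smt (verit) br R_def)
  then have "num_comps V E a b = card (f ` V)"
    by (rule num_comps_eq_card_image)
  also have "f ` V = cl ` V - {cl (b e)}"
  proof -
    have "cl (a e) \<noteq> cl (b e)" using br cl R_def by simp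
    then have "f v \<in> cl ` V - {cl (b e)}" if "v \<in> V" for v
      using V(2) that by (auto simp: f_def cl)
    moreover have "cl v = f v" if "cl v \<noteq> cl (b e)" for v
      using that by (simp add: f_def cl)
    ultimately show ?thesis by blast
  qed
  also have "card \<dots> = card (cl ` V) - 1"
    using V by (simp add: card_Diff_singleton)
  finally have "num_comps V E a b = card (cl ` V) - 1" .
  moreover have "card (cl ` V) > 0" using V by (auto simp: card_gt_0_iff)
  moreover have "num_comps V (E - {e}) a b = card (cl ` V)"
    unfolding num_comps_classes cl_def R_def ..
  ultimately show ?thesis by simp
qed

text \<open>Gluing moves a vertex only along \<open>e\<close>, so every vertex is connected to its
  image. Conversely, a step along \<open>e\<close> collapses to a point.\<close>

lemma adj_contract_iff:
  assumes e: "e \<in> E"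
  shows "(glue (a e) (b e) u, glue (a e) (b e) v)
       \<in> (adj (E - {e}) (glue (a e) (b e) \<circ> a) (glue (a e) (b e) \<circ> b))\<^sup>*
     \<longleftrightarrow> (u, v) \<in> (adj E a b)\<^sup>*" (is "(?g u, ?g v) \<in> ?R'\<^sup>* \<longleftrightarrow> _ \<in> ?R\<^sup>*")
proof
  have gl: "(x, ?g x) \<in> ?R\<^sup>*" "(?g x, x) \<in> ?R\<^sup>*" for x
    using adj_edge[OF e, of a b] sym_adj_rtrancl[of "a e" "b e" E a b] by (auto simp: glue_def)
  have "?R' \<subseteq> ?R\<^sup>*"
  proof
    fix p assume "p \<in> ?R'"
    then obtain x y where p: "p = (?g x, ?g y)" and xy: "(x, y) \<in> ?R"
      by (fastforce simp: adj_def)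
    have "(?g x, x) \<in> ?R\<^sup>*" "(x, y) \<in> ?R\<^sup>*" "(y, ?g y) \<in> ?R\<^sup>*"
      using gl xy by auto
    then show "p \<in> ?R\<^sup>*" unfolding p by (meson rtrancl_trans)
  qed
  then have "?R'\<^sup>* \<subseteq> ?R\<^sup>*" by (rule rtrancl_subset_rtrancl)
  then show "(u, v) \<in> ?R\<^sup>*" if "(?g u, ?g v) \<in> ?R'\<^sup>*"
    using that gl by (meson in_mono rtrancl_trans)
  show "(?g u, ?g v) \<in> ?R'\<^sup>*" if "(u, v) \<in> ?R\<^sup>*"
    using that
  proof (induction rule: rtrancl_induct)
    case (step x y)
    have "(?g x, ?g y) \<in> ?R' \<or> ?g x = ?g y"
      using step(2) unfolding adj_remove[OF e] by (auto simp: adj_def glue_def)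
    then show ?case using step.IH by (metis rtrancl.rtrancl_into_rtrancl)
  qed auto
qed

lemma num_comps_contract:
  assumes e: "e \<in> E" and V: "a e \<in> V" "b e \<in> V" and ij: "a e \<noteq> b e"
  shows "num_comps (V - {b e}) (E - {e}) (glue (a e) (b e) \<circ> a) (glue (a e) (b e) \<circ> b) = num_comps V E a b"
proof -
  let ?g = "glue (a e) (b e)"
  let ?cl = "\<lambda>v. (adj (E - {e}) (?g \<circ> a) (?g \<circ> b))\<^sup>* `` {v}"
  have "?g ` V = V - {b e}"
    using V ij by (auto simp: glue_def)
  then have "num_comps (V - {b e}) (E - {e}) (?g \<circ> a) (?g \<circ> b) = card (?cl ` ?g ` V)"
    by (simp add: num_comps_classes)
  also have "\<dots> = card ((\<lambda>v. ?cl (?g v)) ` V)"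
    by (simp add: image_image)
  also have "\<dots> = num_comps V E a b"
    using adj_contract_iff[OF e, of a b] 
    by (intro num_comps_eq_card_image[symmetric]) (simp only: adj_class_eq_iff)
  finally show ?thesis .
qed

text \<open>Each deletion adds at most one component, so the cycle rank is nonnegative. This keeps
  the subtraction of naturals in \<open>bound\<close> from truncating.\<close>

lemma card_verts_le:
  assumes "finite E" "finite V" "\<And>f. f \<in> E \<Longrightarrow> a f \<in> V \<and> b f \<in> V"
  shows "card V \<le> card E + num_comps V E a b"
  using assms
proof (induction E rule: finite_induct)
  case (insert e E)
  have E: "insert e E - {e} = E" using insert by simp
  have "num_comps V E a b \<le> Suc (num_comps V (insert e E) a b)"
    using num_comps_remove_bridge[of e "insert e E" V a b] num_comps_remove_nonbridge[of e "insert e E" a b V]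
      insert.prems unfolding E by (cases "(a e, b e) \<in> (adj E a b)\<^sup>*") auto
  then show ?case using insert by auto
qed (simp add: num_comps_no_edges)

lemma nonloops_are_bridges_remove:
  assumes "nonloops_are_bridges E a b"
  shows "nonloops_are_bridges (E - {e}) a b"
  unfolding nonloops_are_bridges_def
proof (intro ballI impI notI)
  fix f assume f: "f \<in> E - {e}" "a f \<noteq> b f" "(a f, b f) \<in> (adj (E - {e} - {f}) a b)\<^sup>*"
  have "adj (E - {e} - {f}) a b \<subseteq> adj (E - {f}) a b" by (rule adj_mono) auto
  then have "(a f, b f) \<in> (adj (E - {f}) a b)\<^sup>*" using rtrancl_mono f(3) by blast
  then show False using assms f by (auto simp: nonloops_are_bridges_def)
qed

text \<open>Contracting \<open>e\<close> commutes with deleting \<open>f\<close>, and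
  \<open>e\<close> is still present after deleting \<open>f\<close>, so a connection in the
  contraction lifts.\<close>

lemma nonloops_are_bridges_contract:
  assumes "nonloops_are_bridges E a b" and e: "e \<in> E"
  shows "nonloops_are_bridges (E - {e}) (glue (a e) (b e) \<circ> a) (glue (a e) (b e) \<circ> b)" (is "nonloops_are_bridges _ ?a ?b")
  unfolding nonloops_are_bridges_def
proof (intro ballI impI notI)
  fix f assume f: "f \<in> E - {e}" "?a f \<noteq> ?b f" "(?a f, ?b f) \<in> (adj (E - {e} - {f}) ?a ?b)\<^sup>*"
  have "e \<in> E - {f}" "E - {e} - {f} = E - {f} - {e}" using f e by auto
  then have "(a f, b f) \<in> (adj (E - {f}) a b)\<^sup>*"
    using f(3) adj_contract_iff[of e "E - {f}" a b "a f" "b f"] by simp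
  moreover have "a f \<noteq> b f" using f(2) by auto
  ultimately show False using assms f by (auto simp: nonloops_are_bridges_def)
qed

section \<open>The numerator of the Hilbert series\<close>

abbreviation (input) nonneg_coeffs :: "real poly \<Rightarrow> bool" where
  "nonneg_coeffs p \<equiv> \<forall>i. 0 \<le> coeff p i"

lemma nonneg_coeffs_mult: "nonneg_coeffs p \<Longrightarrow> nonneg_coeffs q \<Longrightarrow> nonneg_coeffs (p * q)"
  by (auto simp: coeff_mult intro!: sum_nonneg)

lemma nonneg_coeffs_linear: "0 \<le> c \<Longrightarrow> 0 \<le> d \<Longrightarrow> nonneg_coeffs [:c, d:]"
  by (auto simp: coeff_pCons split: nat.split)

lemma power_loop: "L * A * u ^ (p + Suc q) = L * u * (A * u ^ (p + q))"
  for u :: "'a::comm_semiring_1"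
  by (simp add: mult_ac)

text \<open>With \<open>u\<close> as 1 - z, one power clears the denominator of \<open>L\<close> and
  two clear that of \<open>M\<close>. Here \<open>p\<close> counts the vertices of the contraction,
  \<open>Suc p\<close> those of the deletion, and \<open>q\<close> the remaining edges.\<close>

lemma power_nonloop:
  "(L * A + M * B) * u ^ (Suc p + Suc q) = L * u * (A * u ^ (Suc p + q)) + M * u\<^sup>2 * (B * u ^ (p + q))"
  for u :: "'a::comm_semiring_1"
  by (simp add: algebra_simps power2_eq_square)

definition bound :: "'v set \<Rightarrow> 'e set \<Rightarrow> ('e \<Rightarrow> 'v) \<Rightarrow> ('e \<Rightarrow> 'v) \<Rightarrow> real poly" where
  "bound V E a b = [:1, 3:] ^ (card V - num_comps V E a b) *
     [:1, 1:] ^ (card E + num_comps V E a b - card V)"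

context
  fixes V :: "'v::finite set" and E :: "'e::finite set" and a b :: "'e \<Rightarrow> 'v" and e :: 'e
  assumes wf: "\<And>f. f \<in> E \<Longrightarrow> a f \<in> V \<and> b f \<in> V" and e: "e \<in> E"
begin

text \<open>The components stay and the cycle rank drops by one. Loops are covered because the
  closure is reflexive.\<close>

lemma bound_nonbridge:
  assumes "(a e, b e) \<in> (adj (E - {e}) a b)\<^sup>*"
  shows "bound V E a b = [:1, 1:] * bound V (E - {e}) a b"
proof -
  have "card V \<le> card (E - {e}) + num_comps V (E - {e}) a b"
    using wf by (intro card_verts_le) auto
  moreover have "card E = Suc (card (E - {e}))"
    using card_Suc_Diff1[OF _ e] by simp
  moreover have "num_comps V (E - {e}) a b = num_comps V E a b"
    by (rule num_comps_remove_nonbridge[OF e assms])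
  ultimately have "card E + num_comps V E a b - card V =
      Suc (card (E - {e}) + num_comps V (E - {e}) a b - card V)"
    by linarith
  then show ?thesis
    unfolding bound_def \<open>num_comps V (E - {e}) a b = num_comps V E a b\<close>
    by (simp only: power_Suc mult_ac)
qed

text \<open>Deletion gains a component, contraction loses a vertex: either way |V| - k drops by one
  and the cycle rank stays.\<close>

lemma bound_bridge:
  assumes "(a e, b e) \<notin> (adj (E - {e}) a b)\<^sup>*"
  shows "bound V E a b = [:1, 3:] * bound V (E - {e}) a b"
    and "bound (V - {b e}) (E - {e}) (glue (a e) (b e) \<circ> a) (glue (a e) (b e) \<circ> b) = bound V (E - {e}) a b"
proof -
  have ab: "a e \<noteq> b e" using assms by auto
  have V: "a e \<in> V" "b e \<in> V" using wf e by auto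
  have le: "num_comps V (E - {e}) a b \<le> card V" by (simp add: num_comps_le)
  have E: "card E = Suc (card (E - {e}))" and cV: "card V = Suc (card (V - {b e}))"
    using card_Suc_Diff1[OF _ e] card_Suc_Diff1[OF _ V(2)] by simp_all
  have nc: "num_comps V (E - {e}) a b = Suc (num_comps V E a b)"
    using num_comps_remove_bridge[OF e _ V assms] by simp
  have "card V - num_comps V E a b = Suc (card V - num_comps V (E - {e}) a b)"
    "card E + num_comps V E a b - card V = card (E - {e}) + num_comps V (E - {e}) a b - card V"
    using le E nc by linarith+
  then show "bound V E a b = [:1, 3:] * bound V (E - {e}) a b"
    unfolding bound_def by (simp only: power_Suc mult.assoc)
  have "card (V - {b e}) - num_comps V E a b = card V - num_comps V (E - {e}) a b"
    "card (E - {e}) + num_comps V E a b - card (V - {b e}) = card (E - {e}) + num_comps V (E - {e}) a b - card V"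
    using cV nc by linarith+
  then show "bound (V - {b e}) (E - {e}) (glue (a e) (b e) \<circ> a) (glue (a e) (b e) \<circ> b) = bound V (E - {e}) a b"
    unfolding bound_def num_comps_contract[of e E a V b, OF e V ab] by (simp only:)
qed

lemma hilb_loop_numerator:
  assumes ab: "a e = b e"
    and h: "hilb V (E - {e}) a b * (1 - fps_X) ^ (card V + card (E - {e})) = fps_of_poly h"
  shows "hilb V E a b * (1 - fps_X) ^ (card V + card E) = fps_of_poly ([:1, 1:] * h)"
proof -
  have "card E = Suc (card (E - {e}))"
    using card_Suc_Diff1[OF _ e] by simp
  then have "hilb V E a b * (1 - fps_X) ^ (card V + card E) =
      loop_series * (1 - fps_X) * (hilb V (E - {e}) a b * (1 - fps_X) ^ (card V + card (E - {e})))"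
    using hilb_loop[of e E b V a] e wf ab by (simp only: power_loop)
  also have "\<dots> = fps_of_poly ([:1, 1:] * h)"
    unfolding loop_series h by (simp add: fps_of_poly_mult fps_of_poly_pCons)
  finally show ?thesis .
qed

lemma hilb_nonloop_numerator:
  assumes ab: "a e \<noteq> b e"
    and h1: "hilb V (E - {e}) a b * (1 - fps_X) ^ (card V + card (E - {e})) = fps_of_poly h1"
    and h2: "hilb (V - {b e}) (E - {e}) (glue (a e) (b e) \<circ> a) (glue (a e) (b e) \<circ> b)
      * (1 - fps_X) ^ (card (V - {b e}) + card (E - {e})) = fps_of_poly h2"
  shows "hilb V E a b * (1 - fps_X) ^ (card V + card E) = fps_of_poly ([:1, 1:] * h1 + [:0, 2:] * h2)"
proof -
  have V: "a e \<in> V" "b e \<in> V" using wf e by auto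
  let ?c = "hilb (V - {b e}) (E - {e}) (glue (a e) (b e) \<circ> a) (glue (a e) (b e) \<circ> b)"
  have "card E = Suc (card (E - {e}))" "card V = Suc (card (V - {b e}))"
    using card_Suc_Diff1[OF _ e] card_Suc_Diff1[OF _ V(2)] by simp_all
  then have "hilb V E a b * (1 - fps_X) ^ (card V + card E) =
      loop_series * (1 - fps_X) * (hilb V (E - {e}) a b * (1 - fps_X) ^ (card V + card (E - {e}))) +
      linear_series * (1 - fps_X)\<^sup>2 * (?c * (1 - fps_X) ^ (card (V - {b e}) + card (E - {e})))"
    unfolding hilb_nonloop[of e E a V b, OF e V ab]
    by (simp only: power_nonloop)
  also have "\<dots> = fps_of_poly ([:1, 1:] * h1 + [:0, 2:] * h2)"
    unfolding loop_series linear_series h1 h2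
    by (simp add: fps_of_poly_mult fps_of_poly_add fps_of_poly_pCons numeral_fps_const)
  finally show ?thesis .
qed

end

text \<open>Nonnegativity and the constant coefficient are carried along for the strict case, where
  the contraction enters only through them.\<close>

lemma hilb_numerator:
  fixes V :: "'v::finite set" and E :: "'e::finite set"
  assumes "\<And>f. f \<in> E \<Longrightarrow> a f \<in> V \<and> b f \<in> V"
  shows "\<exists>h. hilb V E a b * (1 - fps_X) ^ (card V + card E) = fps_of_poly h \<and>
     nonneg_coeffs h \<and> coeff h 0 = 1 \<and> bound V E a b \<preceq> h \<and>
     (bound V E a b = h \<longleftrightarrow> nonloops_are_bridges E a b)"
  using assms
proof (induction "card E" arbitrary: V E a b)
  case 0
  then have "E = {}" by simp
  then show ?case
    using hilb_no_edges[of V a b]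
    by (intro exI[of _ 1])
      (simp add: bound_def num_comps_no_edges nonloops_are_bridges_def coeff_le_def)
next
  case (Suc n)
  note wf = Suc.prems
  have pos: "nonneg_coeffs [:1, 1::real:]" "nonneg_coeffs [:0, 2::real:]" 
    by (intro nonneg_coeffs_linear; simp)+
  have del: "\<exists>h. hilb V (E - {e}) a b * (1 - fps_X) ^ (card V + card (E - {e})) = fps_of_poly h \<and>
     nonneg_coeffs h \<and> coeff h 0 = 1 \<and> bound V (E - {e}) a b \<preceq> h \<and>
     (bound V (E - {e}) a b = h \<longleftrightarrow> nonloops_are_bridges (E - {e}) a b)" if "e \<in> E" for e
    using Suc.hyps(2) wf that by (intro Suc.hyps(1)) auto
  have con: "\<exists>h. hilb (V - {b e}) (E - {e}) (glue (a e) (b e) \<circ> a) (glue (a e) (b e) \<circ> b)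
         * (1 - fps_X) ^ (card (V - {b e}) + card (E - {e})) = fps_of_poly h \<and>
     nonneg_coeffs h \<and> coeff h 0 = 1 \<and>
     bound (V - {b e}) (E - {e}) (glue (a e) (b e) \<circ> a) (glue (a e) (b e) \<circ> b) \<preceq> h \<and>
     (bound (V - {b e}) (E - {e}) (glue (a e) (b e) \<circ> a) (glue (a e) (b e) \<circ> b) = h \<longleftrightarrow>
       nonloops_are_bridges (E - {e}) (glue (a e) (b e) \<circ> a) (glue (a e) (b e) \<circ> b))"
    if "e \<in> E" "a e \<noteq> b e" for e
    using Suc.hyps(2) wf that by (intro Suc.hyps(1)) (auto simp: glue_def)
  show ?case
  proof (cases "nonloops_are_bridges E a b")
    case True
    \<comment> \<open>Any edge will do: deletion and contraction inherit the condition, so the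
      induction hypothesis gives their numerators exactly.\<close>
    obtain e where e: "e \<in> E" using Suc.hyps(2) by fastforce
    obtain h1 where h1: "hilb V (E - {e}) a b * (1 - fps_X) ^ (card V + card (E - {e})) = fps_of_poly h1"
        "nonneg_coeffs h1" "coeff h1 0 = 1" "bound V (E - {e}) a b = h1"
      using del[OF e] nonloops_are_bridges_remove[OF True, of e] by auto
    show ?thesis
    proof (cases "a e = b e")
      case loop: True
      have "bound V E a b = [:1, 1:] * h1"
        using bound_nonbridge[of E a V b e] wf e loop h1(4) by simp
      then show ?thesis
        using hilb_loop_numerator[of E a V b e h1] wf e loop h1 True nonneg_coeffs_mult[OF pos(1) h1(2)]
        by (intro exI[of _ "[:1, 1:] * h1"]) (simp add: coeff_le_def)
    next
      case nonloop: False
      then have br: "(a e, b e) \<notin> (adj (E - {e}) a b)\<^sup>*"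
        using True e by (simp add: nonloops_are_bridges_def)
      obtain h2 where h2: "hilb (V - {b e}) (E - {e}) (glue (a e) (b e) \<circ> a) (glue (a e) (b e) \<circ> b)
         * (1 - fps_X) ^ (card (V - {b e}) + card (E - {e})) = fps_of_poly h2"
        "nonneg_coeffs h2"
        "bound (V - {b e}) (E - {e}) (glue (a e) (b e) \<circ> a) (glue (a e) (b e) \<circ> b) = h2"
        using con[OF e nonloop] nonloops_are_bridges_contract[OF True e] by auto
      \<comment> \<open>At a bridge both numerators equal the common bound of deletion and
        contraction.\<close>
      have "h2 = h1" using bound_bridge(2)[of E a V b e] wf e br h1(4) h2(3) by simp
      then have "bound V E a b = [:1, 1:] * h1 + [:0, 2:] * h2"
        using bound_bridge(1)[of E a V b e] wf e br h1(4)
        by (simp add: distrib_right[symmetric] del: mult_pCons_left)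
      then show ?thesis
        using hilb_nonloop_numerator[of E a V b e h1 h2] wf e nonloop h1 h2 True
          nonneg_coeffs_mult[OF pos(1) h1(2)] nonneg_coeffs_mult[OF pos(2) h2(2)]
        by (intro exI[of _ "[:1, 1:] * h1 + [:0, 2:] * h2"]) (simp add: coeff_le_def)
    qed
  next
    case False
    then obtain e where e: "e \<in> E" and nonloop: "a e \<noteq> b e"
      and nb: "(a e, b e) \<in> (adj (E - {e}) a b)\<^sup>*"
      by (auto simp: nonloops_are_bridges_def)
    obtain h1 where h1: "hilb V (E - {e}) a b * (1 - fps_X) ^ (card V + card (E - {e})) = fps_of_poly h1"
        "nonneg_coeffs h1" "coeff h1 0 = 1" "bound V (E - {e}) a b \<preceq> h1"
      using del[OF e] by blast
    obtain h2 where h2: "hilb (V - {b e}) (E - {e}) (glue (a e) (b e) \<circ> a) (glue (a e) (b e) \<circ> b)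
         * (1 - fps_X) ^ (card (V - {b e}) + card (E - {e})) = fps_of_poly h2"
        "nonneg_coeffs h2" "coeff h2 0 = 1"
      using con[OF e nonloop] by blast
    define h where "h = [:1, 1:] * h1 + [:0, 2:] * h2"
    have d1: "nonneg_coeffs (h1 - bound V (E - {e}) a b)"
      using h1(4) by (simp add: coeff_le_def)
    have diff: "h - bound V E a b = [:1, 1:] * (h1 - bound V (E - {e}) a b) + [:0, 2:] * h2"
      using bound_nonbridge[of E a V b e] wf e nb by (simp add: h_def algebra_simps)
    have "coeff h i - coeff (bound V E a b) i =
        coeff ([:1, 1:] * (h1 - bound V (E - {e}) a b)) i + coeff ([:0, 2:] * h2) i" for i
      by (simp only: coeff_diff[symmetric] diff coeff_add)
    then have ge: "coeff h i - coeff (bound V E a b) i \<ge> coeff ([:0, 2:] * h2) i" for i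
      using nonneg_coeffs_mult[OF pos(1) d1] by simp
    have "bound V E a b \<preceq> h"
      unfolding coeff_le_def using ge nonneg_coeffs_mult[OF pos(2) h2(2)] by (smt (verit))
    \<comment> \<open>At index 1 the excess is at least \<open>2 * coeff h2 0\<close>, which is
      2.\<close>
    moreover have "bound V E a b \<noteq> h"
      using ge[of 1] h2(3) by auto
    moreover have "nonneg_coeffs h"
      unfolding h_def using nonneg_coeffs_mult[OF pos(1) h1(2)] nonneg_coeffs_mult[OF pos(2) h2(2)]
      by simp
    moreover have "coeff h 0 = 1"
      using h1(3) by (simp add: h_def)
    moreover have "hilb V E a b * (1 - fps_X) ^ (card V + card E) = fps_of_poly h"
      unfolding h_def using hilb_nonloop_numerator[of E a V b e h1 h2] wf e nonloop h1 h2 by simp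
    ultimately show ?thesis using False by blast
  qed
qed

section \<open>The lattice points of the dilated polytope\<close>

text \<open>\<open>Upair\<close> has no order, while \<open>shift\<close> needs a direction along
  each edge; any choice serves.\<close>

definition orients :: "('v, 'e) multigraph \<Rightarrow> ('e \<Rightarrow> 'v) \<Rightarrow> ('e \<Rightarrow> 'v) \<Rightarrow> bool" where
  "orients G a b \<longleftrightarrow> (\<forall>f\<in>edges G. ends G f = Upair (a f) (b f))"

lemma ex_orients: obtains a b where "orients G a b"
proof -
  have "\<forall>f. \<exists>p. ends G f = Upair (fst p) (snd p)"
    by (metis fst_conv snd_conv uprod_exhaust)
  then obtain p where "\<And>f. ends G f = Upair (fst (p f)) (snd (p f))" by metis
  then show thesis using that[of "fst \<circ> p" "snd \<circ> p"] by (simp add: orients_def)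
qed

lemma adjacency_eq_adj: "orients G a b \<Longrightarrow> adjacency G = adj (edges G) a b"
  by (auto simp: adjacency_def adj_def orients_def)

definition vec_of :: "('v::finite \<Rightarrow> int) \<times> ('e::finite \<Rightarrow> int) \<Rightarrow> real ^ ('v + 'e)" where
  "vec_of p = (\<chi> c. case c of Inl v \<Rightarrow> of_int (fst p v) | Inr f \<Rightarrow> of_int (snd p f))"

lemma vec_of_nth [simp]:
  "vec_of (x, y) $ Inl v = of_int (x v)" "vec_of (x, y) $ Inr f = of_int (y f)"
  by (simp_all add: vec_of_def)

lemma unit_vec_nth [simp]:
  "unit_vec (Inl v) $ Inl w = of_bool (w = v)" "unit_vec (Inl v) $ Inr f = 0"
  "unit_vec (Inr f) $ Inr g = of_bool (g = f)" "unit_vec (Inr f) $ Inl v = 0"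
  by (auto simp: unit_vec_def axis_def)

lemma vec_eq_sum_type_iff:
  fixes p q :: "real ^ ('v::finite + 'e::finite)"
  shows "p = q \<longleftrightarrow> (\<forall>v. p $ Inl v = q $ Inl v) \<and> (\<forall>f. p $ Inr f = q $ Inr f)"
  by (auto simp: vec_eq_iff split_sum_all)

lemma inj_vec_of: "inj vec_of"
  by (rule injI) (auto simp: vec_eq_sum_type_iff fun_eq_iff)

definition real_slack ::
    "('e::finite \<Rightarrow> 'v::finite) \<Rightarrow> ('e \<Rightarrow> 'v) \<Rightarrow> real ^ ('v + 'e) \<Rightarrow> 'v set \<Rightarrow> real" where
  "real_slack a b p S = slack a b (\<lambda>v. p $ Inl v) (\<lambda>f. p $ Inr f) S"

lemma of_int_edge_term: "edge_term a b S f (of_int m :: real) = of_int (edge_term a b S f m)"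
  by (cases "m \<ge> 0") (simp_all add: edge_term_nonneg edge_term_nonpos)

lemma real_slack_vec_of: "real_slack a b (vec_of (x, y)) S = of_int (slack a b x y S)"
  by (simp add: real_slack_def slack_def of_int_edge_term)

text \<open>A minimum of two linear functions is concave and positively homogeneous.\<close>

lemma edge_term_superlinear:
  fixes y z :: real
  assumes "0 \<le> u" "0 \<le> w"
  shows "u * edge_term a b S f y + w * edge_term a b S f z \<le> edge_term a b S f (u * y + w * z)"
proof -
  have "u * min (c * y) (d * y) + w * min (c * z) (d * z) \<le> min (c * (u * y + w * z)) (d * (u * y + w * z))" for c d
  proof (rule min.boundedI)
    have "u * min (c * y) (d * y) \<le> u * (c * y)" "w * min (c * z) (d * z) \<le> w * (c * z)"
      using assms by (intro mult_left_mono min.cobounded1; simp)+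
    then show "u * min (c * y) (d * y) + w * min (c * z) (d * z) \<le> c * (u * y + w * z)"
      by (simp add: algebra_simps)
    have "u * min (c * y) (d * y) \<le> u * (d * y)" "w * min (c * z) (d * z) \<le> w * (d * z)"
      using assms by (intro mult_left_mono min.cobounded2; simp)+
    then show "u * min (c * y) (d * y) + w * min (c * z) (d * z) \<le> d * (u * y + w * z)"
      by (simp add: algebra_simps)
  qed
  then show ?thesis unfolding edge_term_def .
qed

lemma real_slack_superlinear:
  assumes "0 \<le> u" "0 \<le> w"
  shows "u * real_slack a b p S + w * real_slack a b q S \<le> real_slack a b (u *\<^sub>R p + w *\<^sub>R q) S"
proof -
  have "(\<Sum>f\<in>UNIV. u * edge_term a b S f (p $ Inr f) + w * edge_term a b S f (q $ Inr f))
      \<le> (\<Sum>f\<in>UNIV. edge_term a b S f (u * p $ Inr f + w * q $ Inr f))"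
    by (intro sum_mono edge_term_superlinear assms)
  then show ?thesis
    by (simp add: real_slack_def slack_def sum.distrib sum_distrib_left distrib_left)
qed

lemma real_slack_generator:
  "real_slack a b (\<alpha> *\<^sub>R unit_vec (Inl i) + \<beta> *\<^sub>R unit_vec (Inl j) + \<gamma> *\<^sub>R unit_vec (Inr f)) S =
     \<alpha> * of_bool (i \<in> S) + \<beta> * of_bool (j \<in> S) + edge_term a b S f \<gamma>"
proof -
  have "(\<Sum>g\<in>UNIV. edge_term a b S g (\<gamma> * of_bool (g = f))) = edge_term a b S f \<gamma>"
    by (subst sum.remove[of _ f]) (auto intro!: sum.neutral)
  then show ?thesis
    by (simp add: real_slack_def slack_def sum.distrib sum_mult_of_bool_eq)
qed

definition edge_gens :: "('e::finite \<Rightarrow> 'v::finite) \<Rightarrow> ('e \<Rightarrow> 'v) \<Rightarrow> 'e \<Rightarrow> (real ^ ('v + 'e)) set" where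
  "edge_gens a b f =
     {unit_vec (Inl (a f)) + unit_vec (Inl (b f)) - unit_vec (Inr f),
      unit_vec (Inl (a f)) - unit_vec (Inl (b f)) + unit_vec (Inr f),
      - unit_vec (Inl (a f)) + unit_vec (Inl (b f)) + unit_vec (Inr f)}"

lemma cosmological_polytope_eq:
  assumes "orients G a b"
  shows "cosmological_polytope G = convex hull (\<Union>f\<in>edges G. edge_gens a b f)"
proof -
  have *: "{unit_vec (Inl i) + unit_vec (Inl j) - unit_vec (Inr f),
           unit_vec (Inl i) - unit_vec (Inl j) + unit_vec (Inr f),
           - unit_vec (Inl i) + unit_vec (Inl j) + unit_vec (Inr f)} = edge_gens a b f"
    if "f \<in> edges G" "ends G f = Upair i j" for i j f
    using assms that by (auto simp: orients_def edge_gens_def)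
  have "{{unit_vec (Inl i) + unit_vec (Inl j) - unit_vec (Inr f),
           unit_vec (Inl i) - unit_vec (Inl j) + unit_vec (Inr f),
           - unit_vec (Inl i) + unit_vec (Inl j) + unit_vec (Inr f)} | i j f.
          f \<in> edges G \<and> ends G f = Upair i j} = edge_gens a b ` edges G" (is "?A = ?B")
  proof
    show "?A \<subseteq> ?B" using * by blast
    show "?B \<subseteq> ?A" using assms by (fastforce simp: edge_gens_def orients_def)
  qed
  then show ?thesis by (simp add: cosmological_polytope_def)
qed

text \<open>The slicing read as a decomposition: edges are stripped off one by one, each paid for
  with its own generators. The unit vectors at \<open>V\<close> are assumed separately because
  stripping can isolate vertices whose coordinates are still positive.\<close>

lemma vec_of_in_cone:
  fixes E :: "'e::finite set" and V :: "'v::finite set"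
  assumes K: "0 \<in> K" "\<And>p q. p \<in> K \<Longrightarrow> q \<in> K \<Longrightarrow> p + q \<in> K" "\<And>c p. 0 \<le> c \<Longrightarrow> p \<in> K \<Longrightarrow> c *\<^sub>R p \<in> K"
    and V: "\<And>v. v \<in> V \<Longrightarrow> unit_vec (Inl v) \<in> K"
    and "\<And>f. f \<in> E \<Longrightarrow> edge_gens a b f \<subseteq> K"
    and "(x, y) \<in> cone_points V E a b"
    and "\<And>f. f \<in> E \<Longrightarrow> a f \<in> V \<and> b f \<in> V"
  shows "vec_of (x, y) \<in> K"
  using finite[of E] assms(5-)
proof (induction E arbitrary: x y rule: finite_induct)
  case empty
  then have y: "y = (\<lambda>_. 0)" and x: "\<And>v. v \<notin> V \<Longrightarrow> x v = 0"
    and sl: "\<And>S. 0 \<le> slack a b x y S"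
    by (auto simp: cone_points_def)
  have nonneg: "0 \<le> x v" for v
    using sl[of "{v}"] by (simp add: slack_def y)
  have in_K: "(\<Sum>v\<in>A. of_int (x v) *\<^sub>R unit_vec (Inl v)) \<in> K" if "A \<subseteq> V" for A
    using finite[of A] that
  proof (induction A rule: finite_induct)
    case (insert v A)
    then have "of_int (x v) *\<^sub>R unit_vec (Inl v) + (\<Sum>v\<in>A. of_int (x v) *\<^sub>R unit_vec (Inl v)) \<in> K"
      by (intro K(2)[OF K(3)[OF _ V]]) (simp_all add: nonneg)
    then show ?case using insert.hyps by simp
  qed (simp add: K)
  have "V \<inter> {v} = (if v \<in> V then {v} else {})" for v by auto
  then have "vec_of (x, y) = (\<Sum>v\<in>V. of_int (x v) *\<^sub>R unit_vec (Inl v))"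
    using x by (auto simp: vec_eq_sum_type_iff y)
  then show ?case using in_K[of V] by simp
next
  case (insert e E)
  let ?i = "unit_vec (Inl (a e)) :: real ^ ('v + 'e)" and ?j = "unit_vec (Inl (b e)) :: real ^ ('v + 'e)"
    and ?f = "unit_vec (Inr e) :: real ^ ('v + 'e)"
  have g: "?i + ?j - ?f \<in> K" "?i - ?j + ?f \<in> K" "- ?i + ?j + ?f \<in> K"
    using insert.prems(1)[of e] by (auto simp: edge_gens_def)
  have ab: "a e \<in> V" "b e \<in> V" using insert.prems(3) by auto
  \<comment> \<open>The unit vector of an edge is the midpoint of two of its generators.\<close>
  have "(1/2) *\<^sub>R ((?i - ?j + ?f) + (- ?i + ?j + ?f)) \<in> K"
    by (rule K(3)[OF _ K(2)[OF g(2,3)]]) simp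
  moreover have "(1/2) *\<^sub>R ((?i - ?j + ?f) + (- ?i + ?j + ?f)) = ?f"
    by (simp add: vec_eq_iff field_simps)
  ultimately have f: "?f \<in> K" by simp
  have IH: "vec_of (x', y(e := 0)) \<in> K"
    if "\<And>v. v \<notin> V \<Longrightarrow> x' v = 0" "\<And>S. 0 \<le> slack a b x' (y(e := 0)) S" for x'
  proof (rule insert.IH)
    have "(y(e := 0)) f = 0" if "f \<notin> E" for f
      using insert.prems(2) that by (simp add: cone_points_def)
    then show "(x', y(e := 0)) \<in> cone_points V E a b"
      using that unfolding cone_points_def by blast
  qed (use insert.prems in auto)
  have xy: "\<And>v. v \<notin> V \<Longrightarrow> x v = 0" "\<And>S. 0 \<le> slack a b x y S"
    using insert.prems(2) by (auto simp: cone_points_def)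
  consider (neg) "y e \<le> 0" | (nonneg) "y e \<ge> 0" "a e \<noteq> b e" | (loop) "y e \<ge> 0" "a e = b e" by linarith
  then show ?case
  proof cases
    case neg
    let ?x = "\<lambda>v. x v + y e * (of_bool (v = a e) + of_bool (v = b e))"
    have "vec_of (?x, y(e := 0)) \<in> K"
    proof (rule IH)
      show "?x v = 0" if "v \<notin> V" for v
      proof -
        have "v \<noteq> a e" "v \<noteq> b e" using ab that by auto
        then show ?thesis by (simp add: xy(1)[OF that])
      qed
      show "0 \<le> slack a b ?x (y(e := 0)) S" for S
        using xy(2)[of S] neg_slice[of y e a b x S, OF neg] by (rule ord_le_eq_trans)
    qed
    moreover have "of_int (- y e) *\<^sub>R (?i + ?j - ?f) \<in> K"
      by (rule K(3)[OF _ g(1)]) (use neg in simp)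
    ultimately have "vec_of (?x, y(e := 0)) + of_int (- y e) *\<^sub>R (?i + ?j - ?f) \<in> K"
      by (rule K(2))
    moreover have "vec_of (?x, y(e := 0)) + of_int (- y e) *\<^sub>R (?i + ?j - ?f) = vec_of (x, y)"
      unfolding vec_eq_sum_type_iff by (simp add: of_bool_def)
    ultimately show ?thesis by simp
  next
    case nonneg
    obtain c where c: "\<bar>c\<bar> \<le> y e" "\<And>S. 0 \<le> slack a b (shift (a e) (b e) c x) (y(e := 0)) S"
      using nonneg_slice_iff[of a e b y x] nonneg xy(2) by auto
    let ?x = "shift (a e) (b e) c x"
    have "?x v = 0" if "v \<notin> V" for v using xy(1) ab that by (simp add: shift_outside[of _ V])
    with c(2) have x: "vec_of (?x, y(e := 0)) \<in> K" by (intro IH)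
    \<comment> \<open>Undoing the shift takes \<open>\<bar>c\<bar>\<close> copies of the generator
      pointing the other way, each using one unit of \<open>y e\<close>; the units left over become
      multiples of \<open>?f\<close>.\<close>
    define g where "g = (if c \<ge> 0 then ?i - ?j + ?f else - ?i + ?j + ?f)"
    define r where "r = of_int \<bar>c\<bar> *\<^sub>R g + of_int (y e - \<bar>c\<bar>) *\<^sub>R ?f"
    have "g \<in> K" using g by (simp add: g_def)
    have "r \<in> K"
      unfolding r_def by (rule K(2)[OF K(3)[OF _ \<open>g \<in> K\<close>] K(3)[OF _ f]]) (use c(1) in simp_all)
    then have "vec_of (?x, y(e := 0)) + r \<in> K" by (rule K(2)[OF x])
    moreover have "vec_of (?x, y(e := 0)) + r = vec_of (x, y)"
      unfolding vec_eq_sum_type_iff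
      by (cases "c \<ge> 0") (simp_all add: r_def g_def shift_def of_bool_def)
    ultimately show ?thesis by simp
  next
    case loop
    have sl: "0 \<le> slack a b x (y(e := 0)) S" for S
      using xy(2)[of S] loop_slice[of a e b y x S] loop by simp
    have "vec_of (x, y(e := 0)) \<in> K" by (rule IH[OF _ sl]) (rule xy(1))
    moreover have "of_int (y e) *\<^sub>R ?f \<in> K"
      by (rule K(3)[OF _ f]) (use loop in simp)
    ultimately have "vec_of (x, y(e := 0)) + of_int (y e) *\<^sub>R ?f \<in> K"
      by (rule K(2))
    moreover have "vec_of (x, y(e := 0)) + of_int (y e) *\<^sub>R ?f = vec_of (x, y)"
      by (auto simp: vec_eq_sum_type_iff)
    ultimately show ?thesis by simp
  qed
qed

lemma sum_UNIV_sum_type: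
  fixes p :: "real ^ ('v::finite + 'e::finite)"
  shows "(\<Sum>c\<in>UNIV. p $ c) = (\<Sum>v\<in>UNIV. p $ Inl v) + (\<Sum>f\<in>UNIV. p $ Inr f)"
  by (subst UNIV_Plus_UNIV[symmetric], subst sum.Plus) simp_all

context
  fixes G :: "('v::finite, 'e::finite) multigraph" and a b :: "'e \<Rightarrow> 'v"
  assumes fm: "finite_multigraph G" and iso: "no_isolated_vertices G" and ori: "orients G a b"
begin

lemma ends_in_verts: "f \<in> edges G \<Longrightarrow> a f \<in> verts G \<and> b f \<in> verts G"
  using fm ori by (auto simp: finite_multigraph_def orients_def)

text \<open>The conditions define a convex set, those on the slack by superlinearity, so it suffices
  to check the generators.\<close>

lemma polytope_bounds:
  assumes "p \<in> cosmological_polytope G"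
  shows "v \<notin> verts G \<Longrightarrow> p $ Inl v = 0" "f \<notin> edges G \<Longrightarrow> p $ Inr f = 0"
    "(\<Sum>c\<in>UNIV. p $ c) = 1" "0 \<le> real_slack a b p S"
proof -
  let ?K = "{p :: real ^ ('v + 'e). (\<forall>v. v \<notin> verts G \<longrightarrow> p $ Inl v = 0) \<and> (\<forall>f. f \<notin> edges G \<longrightarrow> p $ Inr f = 0) \<and>
     (\<Sum>c\<in>UNIV. p $ c) = 1 \<and> (\<forall>S. 0 \<le> real_slack a b p S)}"
  have "convex ?K"
  proof (rule convexI)
    fix p q :: "real ^ ('v + 'e)" and u w :: real
    assume pq: "p \<in> ?K" "q \<in> ?K" and uw: "0 \<le> u" "0 \<le> w" "u + w = 1"
    have "0 \<le> real_slack a b (u *\<^sub>R p + w *\<^sub>R q) S" for S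
    proof (rule order_trans[OF _ real_slack_superlinear[OF uw(1,2)]])
      show "0 \<le> u * real_slack a b p S + w * real_slack a b q S"
        using pq uw(1,2) by (intro add_nonneg_nonneg mult_nonneg_nonneg) auto
    qed
    moreover have "(\<Sum>c\<in>UNIV. (u *\<^sub>R p + w *\<^sub>R q) $ c) = 1"
      using pq uw by (simp add: sum.distrib sum_distrib_left[symmetric])
    ultimately show "u *\<^sub>R p + w *\<^sub>R q \<in> ?K"
      using pq unfolding mem_Collect_eq by simp
  qed
  moreover have "edge_gens a b f \<subseteq> ?K" if "f \<in> edges G" for f
  proof -
    note ab = ends_in_verts[OF that]
    have in_K: "\<alpha> *\<^sub>R unit_vec (Inl (a f)) + \<beta> *\<^sub>R unit_vec (Inl (b f)) + \<gamma> *\<^sub>R unit_vec (Inr f) \<in> ?K" (is "?p \<in> _")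
      if sum1: "\<alpha> + \<beta> + \<gamma> = 1"
        and sl: "\<And>S. 0 \<le> \<alpha> * of_bool (a f \<in> S) + \<beta> * of_bool (b f \<in> S) + edge_term a b S f \<gamma>" for \<alpha> \<beta> \<gamma>
    proof -
      have "?p $ Inl v = 0" if "v \<notin> verts G" for v
      proof -
        have "v \<noteq> a f" "v \<noteq> b f" using ab that by auto
        then show ?thesis by simp
      qed
      moreover have "?p $ Inr g = 0" if "g \<notin> edges G" for g
      proof -
        have "g \<noteq> f" using \<open>f \<in> edges G\<close> that by auto
        then show ?thesis by simp
      qed
      moreover have "(\<Sum>c\<in>UNIV. ?p $ c) = 1"
        unfolding sum_UNIV_sum_type using sum1 by (simp add: sum.distrib sum_mult_of_bool_eq)
      moreover have "0 \<le> real_slack a b ?p S" for S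
        unfolding real_slack_generator by (rule sl)
      ultimately show ?thesis by (simp only: mem_Collect_eq) simp
    qed
    have gens: "edge_gens a b f = {1 *\<^sub>R unit_vec (Inl (a f)) + 1 *\<^sub>R unit_vec (Inl (b f)) + (-1) *\<^sub>R unit_vec (Inr f),
        1 *\<^sub>R unit_vec (Inl (a f)) + (-1) *\<^sub>R unit_vec (Inl (b f)) + 1 *\<^sub>R unit_vec (Inr f),
        (-1) *\<^sub>R unit_vec (Inl (a f)) + 1 *\<^sub>R unit_vec (Inl (b f)) + 1 *\<^sub>R unit_vec (Inr f)}"
      by (simp add: edge_gens_def)
    have "0 \<le> 1 * of_bool (a f \<in> S) + 1 * of_bool (b f \<in> S) + edge_term a b S f (- 1 :: real)"
      "0 \<le> 1 * of_bool (a f \<in> S) + (- 1) * of_bool (b f \<in> S) + edge_term a b S f (1 :: real)"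
      "0 \<le> (- 1) * of_bool (a f \<in> S) + 1 * of_bool (b f \<in> S) + edge_term a b S f (1 :: real)" for S
      by (cases "a f \<in> S"; cases "b f \<in> S"; simp add: edge_term_nonneg edge_term_nonpos)+
    then show ?thesis
      unfolding gens by (intro insert_subsetI empty_subsetI in_K) auto
  qed
  ultimately have "cosmological_polytope G \<subseteq> ?K"
    unfolding cosmological_polytope_eq[OF ori] by (intro hull_minimal UN_least)
  then show "v \<notin> verts G \<Longrightarrow> p $ Inl v = 0" "f \<notin> edges G \<Longrightarrow> p $ Inr f = 0"
    "(\<Sum>c\<in>UNIV. p $ c) = 1" "0 \<le> real_slack a b p S"
    using assms by auto
qed

lemma edge_gens_subset: "f \<in> edges G \<Longrightarrow> edge_gens a b f \<subseteq> cosmological_polytope G"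
  unfolding cosmological_polytope_eq[OF ori] by (auto intro: hull_inc)

lemma midpoint_in_polytope:
  "p \<in> cosmological_polytope G \<Longrightarrow> q \<in> cosmological_polytope G \<Longrightarrow> (1/2) *\<^sub>R p + (1/2) *\<^sub>R q \<in> cosmological_polytope G"
  unfolding cosmological_polytope_eq[OF ori] by (rule convexD[OF convex_convex_hull]) auto

lemma unit_vec_edge_in_polytope:
  assumes "f \<in> edges G"
  shows "unit_vec (Inr f) \<in> cosmological_polytope G" "unit_vec (Inl (a f)) \<in> cosmological_polytope G"
    "unit_vec (Inl (b f)) \<in> cosmological_polytope G"
proof -
  let ?i = "unit_vec (Inl (a f)) :: real ^ ('v + 'e)" and ?j = "unit_vec (Inl (b f)) :: real ^ ('v + 'e)"
    and ?f = "unit_vec (Inr f) :: real ^ ('v + 'e)"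
  have g: "?i + ?j - ?f \<in> cosmological_polytope G" "?i - ?j + ?f \<in> cosmological_polytope G"
    "- ?i + ?j + ?f \<in> cosmological_polytope G"
    using edge_gens_subset[OF assms] by (auto simp: edge_gens_def)
  have "(1/2) *\<^sub>R (?i - ?j + ?f) + (1/2) *\<^sub>R (- ?i + ?j + ?f) = ?f"
    "(1/2) *\<^sub>R (?i + ?j - ?f) + (1/2) *\<^sub>R (?i - ?j + ?f) = ?i"
    "(1/2) *\<^sub>R (?i + ?j - ?f) + (1/2) *\<^sub>R (- ?i + ?j + ?f) = ?j"
    by (simp_all add: vec_eq_iff field_simps)
  then show "?f \<in> cosmological_polytope G" "?i \<in> cosmological_polytope G" "?j \<in> cosmological_polytope G"
    using midpoint_in_polytope g by metis+
qed

text \<open>Here the absence of isolated vertices enters: \<open>level\<close> admits positive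
  coordinates at every vertex.\<close>

lemma unit_vec_vertex_in_polytope:
  assumes "v \<in> verts G"
  shows "unit_vec (Inl v) \<in> cosmological_polytope G"
proof -
  obtain f where "f \<in> edges G" "v \<in> set_uprod (ends G f)"
    using iso assms by (auto simp: no_isolated_vertices_def)
  then show ?thesis
    using ori unit_vec_edge_in_polytope[of f] by (auto simp: orients_def)
qed

lemma lattice_points_dilate:
  assumes t: "t \<ge> 1"
  shows "lattice_points ((\<lambda>x. real t *\<^sub>R x) ` cosmological_polytope G) =
     vec_of ` level (verts G) (edges G) a b (int t)"
proof (intro set_eqI iffI)
  fix p assume "p \<in> lattice_points ((\<lambda>x. real t *\<^sub>R x) ` cosmological_polytope G)"
  then obtain q where q: "q \<in> cosmological_polytope G" "p = real t *\<^sub>R q" and int: "\<And>c. p $ c \<in> \<int>"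
    by (auto simp: lattice_points_def)
  define x where "x = (\<lambda>v. \<lfloor>p $ Inl v\<rfloor>)"
  define y where "y = (\<lambda>f. \<lfloor>p $ Inr f\<rfloor>)"
  have p: "p = vec_of (x, y)"
    using int by (simp add: vec_eq_sum_type_iff x_def y_def)
  have "0 \<le> slack a b x y S" for S
  proof -
    have "real t * real_slack a b q S \<le> real_slack a b p S"
      using real_slack_superlinear[of "real t" 0 a b q S 0] q(2) by simp
    then have "0 \<le> real_slack a b p S"
      using polytope_bounds(4)[OF q(1), of S] by (smt (verit) mult_nonneg_nonneg of_nat_0_le_iff)
    then show ?thesis by (simp add: p real_slack_vec_of)
  qed
  moreover have "x v = 0" if "v \<notin> verts G" for v
    using polytope_bounds(1)[OF q(1) that] by (simp add: x_def q(2))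
  moreover have "y f = 0" if "f \<notin> edges G" for f
    using polytope_bounds(2)[OF q(1) that] by (simp add: y_def q(2))
  moreover have "sum x UNIV + sum y UNIV = int t"
  proof -
    have "(\<Sum>c\<in>UNIV. p $ c) = real t"
      using polytope_bounds(3)[OF q(1)] by (simp add: q(2) sum_distrib_left[symmetric])
    then have "real_of_int (sum x UNIV + sum y UNIV) = real_of_int (int t)"
      by (simp add: sum_UNIV_sum_type p)
    then show ?thesis by linarith
  qed
  ultimately show "p \<in> vec_of ` level (verts G) (edges G) a b (int t)"
    unfolding p by (intro imageI) (simp add: level_iff)
next
  fix p assume "p \<in> vec_of ` level (verts G) (edges G) a b (int t)"
  then obtain x y where xy: "(x, y) \<in> level (verts G) (edges G) a b (int t)" and p: "p = vec_of (x, y)"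
    by auto
  let ?C = "cosmological_polytope G"
  \<comment> \<open>A point at a level \<open>t \<ge> 1\<close> excludes the empty graph. The
    polytope is then nonempty, which puts 0 into its cone hull.\<close>
  have "verts G \<noteq> {} \<or> edges G \<noteq> {}"
  proof (rule ccontr)
    assume "\<not> ?thesis"
    then have "x = (\<lambda>_. 0)" "y = (\<lambda>_. 0)" using xy by (auto simp: level_iff)
    then show False using xy t by (simp add: level_iff)
  qed
  then have "?C \<noteq> {}" using unit_vec_vertex_in_polytope unit_vec_edge_in_polytope by blast
  have K: "0 \<in> cone hull ?C" "\<And>p q. p \<in> cone hull ?C \<Longrightarrow> q \<in> cone hull ?C \<Longrightarrow> p + q \<in> cone hull ?C"
    "\<And>c p. 0 \<le> c \<Longrightarrow> p \<in> cone hull ?C \<Longrightarrow> c *\<^sub>R p \<in> cone hull ?C"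
  proof -
    have "convex ?C" by (simp add: cosmological_polytope_def)
    then have "convex (cone hull ?C) \<and> cone (cone hull ?C)"
      by (simp add: convex_cone_hull cone_cone_hull)
    then show "\<And>p q. p \<in> cone hull ?C \<Longrightarrow> q \<in> cone hull ?C \<Longrightarrow> p + q \<in> cone hull ?C"
      "\<And>c p. 0 \<le> c \<Longrightarrow> p \<in> cone hull ?C \<Longrightarrow> c *\<^sub>R p \<in> cone hull ?C"
      by (simp_all add: convex_cone)
    show "0 \<in> cone hull ?C"
      using \<open>?C \<noteq> {}\<close> by (metis cone_hull_contains_0)
  qed
  have "p \<in> cone hull ?C"
    unfolding p
  proof (rule vec_of_in_cone[OF K])
    show "(x, y) \<in> cone_points (verts G) (edges G) a b"
      using xy by (auto simp: level_def)
    show "edge_gens a b f \<subseteq> cone hull ?C" if "f \<in> edges G" for f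
      using edge_gens_subset[OF that] hull_subset[of ?C cone] by blast
  qed (use unit_vec_vertex_in_polytope ends_in_verts in \<open>auto intro: hull_inc\<close>)
  then obtain c q where c: "0 \<le> c" "q \<in> ?C" "p = c *\<^sub>R q"
    by (auto simp: cone_hull_expl)
  have "sum x UNIV + sum y UNIV = int t" using xy by (simp add: level_iff)
  moreover have "(\<Sum>c\<in>UNIV. p $ c) = real_of_int (sum x UNIV + sum y UNIV)"
    by (simp add: p sum_UNIV_sum_type)
  ultimately have "(\<Sum>c\<in>UNIV. p $ c) = real t" by simp
  \<comment> \<open>The coordinate sum is 1 on the polytope, so the scaling factor is the
    level.\<close>
  then have "c = real t"
    using polytope_bounds(3)[OF c(2)] by (simp add: c(3) sum_distrib_left[symmetric])
  moreover have "p $ d \<in> \<int>" for d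
    by (cases d) (simp_all add: p)
  ultimately show "p \<in> lattice_points ((\<lambda>x. real t *\<^sub>R x) ` ?C)"
    using c by (auto simp: lattice_points_def)
qed

lemma ehrhart_series_eq_hilb:
  "ehrhart_series (cosmological_polytope G) = hilb (verts G) (edges G) a b"
proof (rule fps_ext)
  fix t
  have "card (lattice_points ((\<lambda>x. real t *\<^sub>R x) ` cosmological_polytope G)) =
     card (level (verts G) (edges G) a b (int t))" if "t \<ge> 1"
    unfolding lattice_points_dilate[OF that] by (rule card_image) (rule inj_on_subset[OF inj_vec_of], simp)
  then show "fps_nth (ehrhart_series (cosmological_polytope G)) t = fps_nth (hilb (verts G) (edges G) a b) t"
    by (cases t) (auto simp: ehrhart_series_def hilb_def card_level_0)
qed

text \<open>Generators have coefficient sum 1, so the polytope lies between an affinely independent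
  set of unit vectors and its affine hull. The empty graph fits in with dimension -1.\<close>

lemma aff_dim_polytope:
  "nat (aff_dim (cosmological_polytope G) + 1) = card (verts G) + card (edges G)"
proof -
  let ?U = "(unit_vec :: 'v + 'e \<Rightarrow> _) ` (Inl ` verts G \<union> Inr ` edges G)"
  have mem: "\<alpha> *\<^sub>R unit_vec (Inl (a f)) + \<beta> *\<^sub>R unit_vec (Inl (b f)) + \<gamma> *\<^sub>R unit_vec (Inr f) \<in> affine hull ?U"
    if "f \<in> edges G" "\<alpha> + \<beta> + \<gamma> = 1" for f \<alpha> \<beta> \<gamma>
    using ends_in_verts[OF that(1)] that by (intro mem_affine_3 affine_affine_hull hull_inc) auto
  have "edge_gens a b f \<subseteq> affine hull ?U" if "f \<in> edges G" for f
    using mem[OF that, of 1 1 "-1"] mem[OF that, of 1 "-1" 1] mem[OF that, of "-1" 1 1]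
    by (auto simp: edge_gens_def)
  then have "cosmological_polytope G \<subseteq> affine hull ?U"
    unfolding cosmological_polytope_eq[OF ori]
    by (intro hull_minimal UN_least affine_imp_convex affine_affine_hull)
  from aff_dim_subset[OF this] have "aff_dim (cosmological_polytope G) \<le> aff_dim ?U"
    by (simp only: aff_dim_affine_hull)
  moreover have "?U \<subseteq> cosmological_polytope G"
    by (intro image_subsetI) (elim UnE imageE; simp only: unit_vec_vertex_in_polytope unit_vec_edge_in_polytope)
  then have "aff_dim ?U \<le> aff_dim (cosmological_polytope G)"
    by (rule aff_dim_subset)
  moreover have "int (card ?U) = aff_dim ?U + 1"
  proof (rule aff_dim_affine_independent)
    have "?U \<subseteq> Basis" by (auto simp: unit_vec_def Basis_vec_def)
    then have "independent ?U" by (rule independent_mono[OF independent_Basis])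
    then show "\<not> affine_dependent ?U" using affine_dependent_imp_dependent by blast
  qed
  moreover have "card ?U = card (verts G) + card (edges G)"
  proof -
    have "inj (unit_vec :: 'v + 'e \<Rightarrow> _)"
      by (rule injI) (simp add: unit_vec_def axis_eq_axis)
    then have "card ?U = card (Inl ` verts G \<union> Inr ` edges G :: ('v + 'e) set)"
      by (rule card_image[OF inj_on_subset]) simp
    also have "\<dots> = card (verts G) + card (edges G)"
      unfolding Plus_def[symmetric] by (simp add: card_Plus)
    finally show ?thesis .
  qed
  ultimately show ?thesis by linarith
qed

text \<open>The power of \<open>1 - fps_X\<close> is a unit, so division by it is exact and
  determines the numerator uniquely.\<close>

lemma h_star_polytope:
  assumes "hilb (verts G) (edges G) a b * (1 - fps_X) ^ (card (verts G) + card (edges G)) = fps_of_poly h"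
  shows "h_star (cosmological_polytope G) = h"
proof -
  let ?D = "(1 - fps_X :: real fps) ^ (card (verts G) + card (edges G))"
  have unit: "is_unit ?D"
    unfolding fps_is_unit_iff fps_power_zeroth by simp
  then have "?D \<noteq> 0" by (metis not_is_unit_0)
  have "hilb (verts G) (edges G) a b = fps_of_poly h' / ?D \<longleftrightarrow> h' = h" for h'
  proof
    assume eq: "hilb (verts G) (edges G) a b = fps_of_poly h' / ?D"
    have "?D dvd fps_of_poly h'" using unit by (rule unit_imp_dvd)
    then have "fps_of_poly h' / ?D * ?D = fps_of_poly h'" by (rule dvd_div_mult_self)
    then have "fps_of_poly h' = fps_of_poly h"
      using assms unfolding eq by (rule trans[OF sym])
    then show "h' = h" by (simp only: fps_of_poly_eq_iff)
  next
    assume "h' = h"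
    show "hilb (verts G) (edges G) a b = fps_of_poly h' / ?D"
      unfolding \<open>h' = h\<close> assms[symmetric] by (rule nonzero_mult_div_cancel_right[OF \<open>?D \<noteq> 0\<close>, symmetric])
  qed
  then show ?thesis
    unfolding h_star_def ehrhart_series_eq_hilb aff_dim_polytope by simp
qed

end

section \<open>Graphs all of whose non-loop edges are bridges\<close>

definition edge_rel :: "('v, 'e) multigraph \<Rightarrow> 'e set \<Rightarrow> ('v \<times> 'v) set" where
  "edge_rel G F = {(u, v). \<exists>f\<in>F. ends G f = Upair u v}"

text \<open>\<open>nonloops_are_bridges\<close> without a chosen orientation, so that it can be
  transported along isomorphisms and 1-sums.\<close>

definition tree_like :: "('v, 'e) multigraph \<Rightarrow> bool" where
  "tree_like G \<longleftrightarrow> (\<forall>f\<in>edges G. \<forall>u v. ends G f = Upair u v \<longrightarrow> u \<noteq> v \<longrightarrow>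
     (u, v) \<notin> (edge_rel G (edges G - {f}))\<^sup>*)"

lemma tree_like_iff:
  assumes "orients G a b"
  shows "tree_like G \<longleftrightarrow> nonloops_are_bridges (edges G) a b"
proof -
  have rel: "edge_rel G F = adj F a b" if "F \<subseteq> edges G" for F
  proof -
    have "(\<exists>f\<in>F. ends G f = Upair u v) \<longleftrightarrow> (\<exists>f\<in>F. u = a f \<and> v = b f \<or> u = b f \<and> v = a f)" for u v
    proof (rule bex_cong[OF refl])
      fix f assume "f \<in> F"
      then have "ends G f = Upair (a f) (b f)" using assms that by (auto simp: orients_def)
      then show "ends G f = Upair u v \<longleftrightarrow> u = a f \<and> v = b f \<or> u = b f \<and> v = a f" by auto
    qed
    then show ?thesis by (simp add: edge_rel_def adj_def)
  qed
  show ?thesis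
  proof
    assume tl: "tree_like G"
    show "nonloops_are_bridges (edges G) a b"
      unfolding nonloops_are_bridges_def
    proof (intro ballI impI)
      fix f assume f: "f \<in> edges G" "a f \<noteq> b f"
      then have "ends G f = Upair (a f) (b f)" using assms by (simp add: orients_def)
      then have "(a f, b f) \<notin> (edge_rel G (edges G - {f}))\<^sup>*"
        using tl f unfolding tree_like_def by blast
      then show "(a f, b f) \<notin> (adj (edges G - {f}) a b)\<^sup>*" by (simp add: rel)
    qed
  next
    assume br: "nonloops_are_bridges (edges G) a b"
    show "tree_like G"
      unfolding tree_like_def
    proof (intro ballI allI impI notI)
      fix f u v
      assume f: "f \<in> edges G" "ends G f = Upair u v" "u \<noteq> v" "(u, v) \<in> (edge_rel G (edges G - {f}))\<^sup>*"
      have "(u, v) \<in> (adj (edges G - {f}) a b)\<^sup>*" using f(4) by (simp add: rel)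
      moreover have "u = a f \<and> v = b f \<or> u = b f \<and> v = a f"
        using f(1,2) assms by (auto simp: orients_def)
      ultimately show False
        using br f(1,3) sym_adj_rtrancl[of u v] unfolding nonloops_are_bridges_def by metis
    qed
  qed
qed

lemma simple_path:
  assumes "(u, v) \<in> (edge_rel G F)\<^sup>*"
  shows "\<exists>vs fs. length vs = Suc (length fs) \<and> distinct vs \<and> set fs \<subseteq> F \<and> vs ! 0 = u \<and>
     vs ! length fs = v \<and> (\<forall>i<length fs. ends G (fs ! i) = Upair (vs ! i) (vs ! Suc i))"
  using assms
proof (induction rule: rtrancl_induct)
  case base
  show ?case by (intro exI[of _ "[u]"] exI[of _ "[]"]) simp
next
  case (step v w)
  then obtain vs fs where p: "length vs = Suc (length fs)" "distinct vs" "set fs \<subseteq> F" "vs ! 0 = u"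
     "vs ! length fs = v" "\<And>i. i < length fs \<Longrightarrow> ends G (fs ! i) = Upair (vs ! i) (vs ! Suc i)"
    by blast
  obtain f where f: "f \<in> F" "ends G f = Upair v w"
    using step.hyps(2) by (auto simp: edge_rel_def)
  show ?case
  proof (cases "w \<in> set vs")
    \<comment> \<open>The walk returns to a visited vertex, and the initial segment up to that
      vertex is the required path.\<close>
    case True
    then obtain i where i: "i < length vs" "vs ! i = w" by (auto simp: in_set_conv_nth)
    have "i \<le> length fs" using i(1) p(1) by simp
    then show ?thesis
      using p i by (intro exI[of _ "take (Suc i) vs"] exI[of _ "take i fs"])
        (auto simp: min_absorb2 dest: in_set_takeD)
  next
    case False
    show ?thesis
    proof (intro exI[of _ "vs @ [w]"] exI[of _ "fs @ [f]"] conjI allI impI)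
      fix i assume "i < length (fs @ [f])"
      then consider "i < length fs" | "i = length fs" by fastforce
      then show "ends G ((fs @ [f]) ! i) = Upair ((vs @ [w]) ! i) ((vs @ [w]) ! Suc i)"
        using p f by cases (auto simp: nth_append)
    qed (use p f False in \<open>auto simp: nth_append\<close>)
  qed
qed

text \<open>A simple path between the ends of \<open>f\<close> that avoids \<open>f\<close> is
  closed to a cycle by \<open>f\<close>.\<close>

lemma forest_imp_tree_like:
  assumes "is_forest G"
  shows "tree_like G"
  unfolding tree_like_def
proof (intro ballI allI impI notI)
  fix f u v
  assume f: "f \<in> edges G" "ends G f = Upair u v" "u \<noteq> v" "(u, v) \<in> (edge_rel G (edges G - {f}))\<^sup>*"
  obtain vs fs where p: "length vs = Suc (length fs)" "distinct vs" "set fs \<subseteq> edges G - {f}" "vs ! 0 = u"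
     "vs ! length fs = v" "\<And>i. i < length fs \<Longrightarrow> ends G (fs ! i) = Upair (vs ! i) (vs ! Suc i)"
    using simple_path[OF f(4)] by blast
  have wf: "set_uprod (ends G g) \<subseteq> verts G" if "g \<in> edges G" for g
    using assms that by (auto simp: is_forest_def finite_multigraph_def)
  have "is_cycle G vs (fs @ [f])"
    unfolding is_cycle_def
  proof (intro conjI allI impI)
    \<comment> \<open>A repeated edge would join two different pairs of consecutive vertices,
      impossible on a path with distinct vertices.\<close>
    have "distinct fs"
      unfolding distinct_conv_nth
    proof (intro allI impI)
      fix i j assume ij: "i < length fs" "j < length fs" "i \<noteq> j"
      show "fs ! i \<noteq> fs ! j"
      proof
        assume "fs ! i = fs ! j"
        then have "Upair (vs ! i) (vs ! Suc i) = Upair (vs ! j) (vs ! Suc j)"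
          using p(6) ij by metis
        then show False
          using ij p(1,2) by (auto simp: nth_eq_iff_index_eq)
      qed
    qed
    then show "distinct (fs @ [f])" using p(3) by auto
    show "set vs \<subseteq> verts G"
    proof
      fix z assume "z \<in> set vs"
      then obtain i where i: "i < length vs" "z = vs ! i" by (auto simp: in_set_conv_nth)
      show "z \<in> verts G"
      proof (cases "i < length fs")
        case True
        then have "fs ! i \<in> edges G" using p(3) nth_mem by blast
        from wf[OF this] show ?thesis using p(6)[OF True] i(2) by simp
      next
        case False
        then have "z = v" using i p(1,5) by (simp add: less_Suc_eq)
        then show ?thesis using wf[OF f(1)] f(2) by simp
      qed
    qed
    fix i assume "i < length (fs @ [f])"
    then consider "i < length fs" | "i = length fs" by fastforce
    then show "ends G ((fs @ [f]) ! i) = Upair (vs ! i) (vs ! (Suc i mod length (fs @ [f])))"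
    proof cases
      case 1
      then show ?thesis using p(6)[OF 1] by (simp add: nth_append)
    next
      case 2
      then show ?thesis using p(4,5) f(2) by simp
    qed
  qed (use p f in auto)
  then show False using assms by (auto simp: is_forest_def)
qed

text \<open>Without loops a cycle has length at least 2, and its other edges connect the ends of its
  first edge, which is then not a bridge.\<close>

lemma tree_like_imp_forest:
  assumes "tree_like G" "finite_multigraph G" and no_loops: "\<And>f v. f \<in> edges G \<Longrightarrow> ends G f \<noteq> Upair v v"
  shows "is_forest G"
  unfolding is_forest_def
proof (intro conjI notI assms)
  assume "\<exists>vs fs. is_cycle G vs fs"
  then obtain vs fs where c: "fs \<noteq> []" "length vs = length fs" "distinct vs" "distinct fs" "set fs \<subseteq> edges G"
    "\<And>i. i < length fs \<Longrightarrow> ends G (fs ! i) = Upair (vs ! i) (vs ! (Suc i mod length fs))"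
    unfolding is_cycle_def by blast
  define n where "n = length fs"
  have "n > 0" using c(1) by (simp add: n_def)
  have e0: "fs ! 0 \<in> edges G" "ends G (fs ! 0) = Upair (vs ! 0) (vs ! (1 mod n))"
    using c(5) c(6)[of 0] \<open>n > 0\<close> by (auto simp: n_def)
  have "n \<noteq> 1" using no_loops[OF e0(1), of "vs ! 0"] e0(2) by auto
  then have "n > 1" using \<open>n > 0\<close> by simp
  \<comment> \<open>Starting at index 1 skips the edge \<open>fs ! 0\<close>; reducing mod
    \<open>n\<close> makes \<open>i = n\<close> close up at \<open>vs ! 0\<close>.\<close>
  have path: "(vs ! 1, vs ! (i mod n)) \<in> (edge_rel G (edges G - {fs ! 0}))\<^sup>*" if "1 \<le> i" "i \<le> n" for i
    using that
  proof (induction i rule: dec_induct)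
    case base
    then show ?case using \<open>n > 1\<close> by simp
  next
    case (step i)
    then have "i < n" by simp
    have "fs ! i \<in> edges G - {fs ! 0}"
      using c(5) nth_eq_iff_index_eq[OF c(4), of i 0] step(1) \<open>i < n\<close> c(1) by (auto simp: n_def)
    then have "(vs ! (i mod n), vs ! (Suc i mod n)) \<in> edge_rel G (edges G - {fs ! 0})"
      using c(6)[of i] \<open>i < n\<close> by (auto simp: edge_rel_def n_def)
    then show ?case using step by (meson Suc_leD rtrancl.rtrancl_into_rtrancl)
  qed
  have "(vs ! 1, vs ! 0) \<in> (edge_rel G (edges G - {fs ! 0}))\<^sup>*"
    using path[of n] \<open>n > 1\<close> by simp
  moreover have "ends G (fs ! 0) = Upair (vs ! 1) (vs ! 0)" using e0(2) \<open>n > 1\<close> by simp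
  moreover have "vs ! 1 \<noteq> vs ! 0" using nth_eq_iff_index_eq[OF c(3), of 1 0] c(1,2) \<open>n > 1\<close> by (simp add: n_def)
  ultimately show False using assms(1) e0(1) by (auto simp: tree_like_def)
qed

text \<open>Loops are split off one at a time until a forest remains.\<close>

lemma tree_like_imp_one_sum:
  fixes G :: "('v, 'e) multigraph"
  assumes "tree_like G" "finite_multigraph G"
  shows "one_sum_of_loops_and_forest G"
  using assms
proof (induction "card (edges G)" arbitrary: G rule: less_induct)
  case less
  show ?case
  proof (cases "\<exists>f\<in>edges G. \<exists>v. ends G f = Upair v v")
    case False
    then show ?thesis
      using less.prems by (intro forest tree_like_imp_forest) auto
  next
    case True
    then obtain f v where f: "f \<in> edges G" "ends G f = Upair v v" by blast
    \<comment> \<open>All vertices are kept: \<open>v\<close> may become isolated, which a forest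
      permits.\<close>
    define H where "H = G\<lparr>edges := edges G - {f}\<rparr>"
    define L where "L = \<lparr>verts = {v}, edges = {f}, ends = ends G\<rparr>"
    have fin: "finite (edges G)" using less.prems(2) by (simp add: finite_multigraph_def)
    have "tree_like H"
      unfolding tree_like_def
    proof (intro ballI allI impI notI)
      fix g u w
      assume g: "g \<in> edges H" "ends H g = Upair u w" "u \<noteq> w" "(u, w) \<in> (edge_rel H (edges H - {g}))\<^sup>*"
      have "edge_rel H (edges H - {g}) \<subseteq> edge_rel G (edges G - {g})"
        by (auto simp: edge_rel_def H_def)
      then have "(u, w) \<in> (edge_rel G (edges G - {g}))\<^sup>*"
        using g(4) rtrancl_mono by blast
      then show False using less.prems(1) g by (auto simp: tree_like_def H_def)
    qed
    moreover have "finite_multigraph H"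
      using less.prems(2) by (auto simp: finite_multigraph_def H_def)
    moreover have "card (edges H) < card (edges G)"
      using f(1) fin by (simp add: H_def card_Diff1_less del: card_Diff_insert)
    ultimately have "one_sum_of_loops_and_forest H" using less.hyps by blast
    moreover have "is_loop_graph L" using f(2) by (auto simp: is_loop_graph_def L_def)
    moreover have "v \<in> verts H"
      using less.prems(2) f by (fastforce simp: finite_multigraph_def H_def)
    moreover have "v \<in> verts L" by (simp add: L_def)
    moreover have "isomorphic G (one_sum H v L v)"
      unfolding isomorphic_def
    proof (intro exI conjI ballI)
      show "bij_betw Inl (verts G) (verts (one_sum H v L v))"
        by (auto simp: bij_betw_def one_sum_def H_def L_def)
      show "bij_betw (\<lambda>g. if g = f then Inr f else Inl g) (edges G) (edges (one_sum H v L v))"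
        using f(1) by (auto simp: bij_betw_def inj_on_def one_sum_def H_def L_def)
      show "ends (one_sum H v L v) (if g = f then Inr f else Inl g) = map_uprod Inl (ends G g)"
        if "g \<in> edges G" for g
        using f(2) by (auto simp: one_sum_def H_def L_def)
    qed
    ultimately show ?thesis by (rule attach_loop)
  qed
qed

lemma one_sum_imp_tree_like:
  assumes "one_sum_of_loops_and_forest G" "finite_multigraph G"
  shows "tree_like G"
  using assms
proof (induction rule: one_sum_of_loops_and_forest.induct)
  case (forest F)
  show ?case by (rule forest_imp_tree_like[OF forest(1)])
next
  case (attach_loop H L v w G)
  let ?S = "one_sum H v L w"
  obtain \<phi> \<psi> where phi: "bij_betw \<phi> (verts G) (verts ?S)" and psi: "bij_betw \<psi> (edges G) (edges ?S)"
    and ends: "\<And>f. f \<in> edges G \<Longrightarrow> ends ?S (\<psi> f) = map_uprod \<phi> (ends G f)"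
    using attach_loop.hyps unfolding isomorphic_def by blast
  obtain l where L: "verts L = {w}" "edges L = {l}" "ends L l = Upair w w"
    using attach_loop.hyps by (auto simp: is_loop_graph_def)
  have vS: "verts ?S = Inl ` verts H" and eS: "edges ?S = insert (Inr l) (Inl ` edges H)"
    by (auto simp: one_sum_def L)
  have ends_Inl: "ends ?S (Inl g) = map_uprod Inl (ends H g)" for g
    by (simp add: one_sum_def)
  have ends_l: "ends ?S (Inr l) = Upair (Inl v) (Inl v)"
    by (simp add: one_sum_def L)
  have wfG: "set_uprod (ends G f) \<subseteq> verts G" if "f \<in> edges G" for f
    using attach_loop.prems that by (simp add: finite_multigraph_def)
  \<comment> \<open>The induction hypothesis requires this, but the rule does not provide it; it is
    pulled back from \<open>G\<close> along the isomorphism.\<close>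
  have "finite_multigraph H"
    unfolding finite_multigraph_def
  proof (intro conjI ballI)
    have "finite (verts ?S)" "finite (edges ?S)"
      using phi psi attach_loop.prems bij_betw_finite by (auto simp: finite_multigraph_def)
    then show "finite (verts H)" "finite (edges H)"
      by (auto simp: vS eS finite_image_iff)
    fix g assume "g \<in> edges H"
    then have "Inl g \<in> \<psi> ` edges G" using psi by (auto simp: bij_betw_def eS)
    then obtain f where f: "f \<in> edges G" "\<psi> f = Inl g" by force
    have "Inl ` set_uprod (ends H g) = \<phi> ` set_uprod (ends G f)"
      using ends[OF f(1)] f(2) by (metis ends_Inl uprod.set_map)
    also have "\<dots> \<subseteq> Inl ` verts H"
      using wfG[OF f(1)] phi by (auto simp: bij_betw_def vS)
    finally show "set_uprod (ends H g) \<subseteq> verts H" by auto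
  qed
  then have treeH: "tree_like H" by (rule attach_loop.IH)
  \<comment> \<open>Dropping \<open>Inl\<close> after \<phi> sends each edge of \<open>G\<close> to
    an edge of \<open>H\<close> or, for the attached loop, to a point, so walks in \<open>G\<close>
    project to walks in \<open>H\<close>.\<close>
  have edge_step: "projl (\<phi> x) = projl (\<phi> y) \<or> (\<exists>g\<in>edges H. \<psi> f = Inl g \<and> ends H g = Upair (projl (\<phi> x)) (projl (\<phi> y)))"
    if "f \<in> edges G" "ends G f = Upair x y" for f x y
  proof -
    have e: "ends ?S (\<psi> f) = Upair (\<phi> x) (\<phi> y)" using ends[OF that(1)] that(2) by simp
    have "\<psi> f \<in> edges ?S" using psi that(1) by (auto simp: bij_betw_def)
    then consider "\<psi> f = Inr l" | g where "g \<in> edges H" "\<psi> f = Inl g" by (auto simp: eS)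
    then show ?thesis
    proof cases
      case 1
      then show ?thesis using e ends_l by auto
    next
      case 2
      obtain p q where "ends H g = Upair p q" by (metis uprod_exhaust)
      then have "ends H g = map_uprod projl (ends ?S (Inl g))" by (simp add: ends_Inl)
      then show ?thesis using e 2 by simp
    qed
  qed
  show ?case
    unfolding tree_like_def
  proof (intro ballI allI impI notI)
    fix f x y
    assume f: "f \<in> edges G" "ends G f = Upair x y" "x \<noteq> y" and path: "(x, y) \<in> (edge_rel G (edges G - {f}))\<^sup>*"
    have "x \<in> verts G" "y \<in> verts G" using wfG[OF f(1)] f(2) by auto
    then have "\<phi> x \<in> Inl ` verts H" "\<phi> y \<in> Inl ` verts H" "\<phi> x \<noteq> \<phi> y"
      using phi f(3) by (auto simp: bij_betw_def vS inj_on_def)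
    then have ne: "projl (\<phi> x) \<noteq> projl (\<phi> y)" by auto
    then obtain g where g: "g \<in> edges H" "\<psi> f = Inl g" "ends H g = Upair (projl (\<phi> x)) (projl (\<phi> y))"
      using edge_step[OF f(1,2)] by blast
    have "(projl (\<phi> x), projl (\<phi> y)) \<in> (edge_rel H (edges H - {g}))\<^sup>*"
      using path
    proof (induction rule: rtrancl_induct)
      case (step y z)
      then obtain f' where f': "f' \<in> edges G" "f' \<noteq> f" "ends G f' = Upair y z"
        by (auto simp: edge_rel_def)
      \<comment> \<open>Injectivity of \<psi> keeps the projected walk off \<open>g\<close>.\<close>
      have "\<psi> f' \<noteq> Inl g"
        using psi f'(1,2) f(1) g(2) by (metis bij_betw_def inj_onD)
      then have "projl (\<phi> y) = projl (\<phi> z) \<or> (projl (\<phi> y), projl (\<phi> z)) \<in> edge_rel H (edges H - {g})"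
        using edge_step[OF f'(1,3)] by (auto simp: edge_rel_def)
      then show ?case using step.IH by (metis rtrancl.rtrancl_into_rtrancl)
    qed simp
    then show False using treeH g(1,3) ne by (auto simp: tree_like_def)
  qed
qed

theorem theorem3p5:
  fixes G :: "('v::finite, 'e::finite) multigraph" and k :: nat
  assumes "finite_multigraph G" and "no_isolated_vertices G"
    and "k = card (connected_components G)"
  shows "[:1, 3:] ^ (card (verts G) - k) * [:1, 1:] ^ (card (edges G) + k - card (verts G))
           \<preceq> h_star (cosmological_polytope G)
       \<and> ([:1, 3:] ^ (card (verts G) - k) * [:1, 1:] ^ (card (edges G) + k - card (verts G))
             = h_star (cosmological_polytope G)
          \<longleftrightarrow> one_sum_of_loops_and_forest G)"
proof -
  obtain a b where ori: "orients G a b" by (rule ex_orients)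
  have k: "k = num_comps (verts G) (edges G) a b"
    using assms(3) by (simp add: connected_components_def num_comps_def adjacency_eq_adj[OF ori])
  obtain h where h: "hilb (verts G) (edges G) a b * (1 - fps_X) ^ (card (verts G) + card (edges G)) = fps_of_poly h"
    "bound (verts G) (edges G) a b \<preceq> h"
    "bound (verts G) (edges G) a b = h \<longleftrightarrow> nonloops_are_bridges (edges G) a b"
    using hilb_numerator[of "edges G" a "verts G" b] ends_in_verts[OF assms(1,2) ori] by blast
  have "one_sum_of_loops_and_forest G \<longleftrightarrow> nonloops_are_bridges (edges G) a b"
    using tree_like_iff[OF ori] tree_like_imp_one_sum[OF _ assms(1)] one_sum_imp_tree_like[OF _ assms(1)]
    by blast
  then show ?thesis
    using h(2,3) unfolding h_star_polytope[OF assms(1,2) ori h(1)] bound_def k by blast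
qed

end
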